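(* Fix integers $\Delta,k\ge 1$ and reals $0<d\le 1$ and $\kappa,C\ge 1$. There exist positive constants $\theta,\xi_0,\lambda_0,K_0$ (with $\theta\le 1$), an integer $n_0$, and vectors of positive reals $\boldsymbol\varepsilon=(\varepsilon_0,\ldots,\varepsilon_{2\Delta})$ and $\boldsymbol\eta=(\eta_0,\ldots,\eta_{2\Delta-1})$ such that the following holds. Let $G\subseteq\Gamma$ be $k$-partite graphs on the same vertex set with common parts $V_1,\ldots,V_k$, where $M\le |V_i|\le\kappa M$ for every $i\in[k]$. Let $0<p\le 1$, write $K=p^\Delta M$, and let $\xi$ be a real number. Let $H$ be an $n$-vertex graph with $n\ge n_0$, maximum degree at most $\Delta$, and a proper assignment $\chi:V(H)\to[k]$ satisfying $|\chi^{-1}(i)|\le |V_i|$ for every $i\in[k]$. Suppose that $H$ has a separated buffer $B\subseteq V(H)$. Assume also that $$K\ge K_0\log(2n),\qquad (p+\xi)\,n\log(2n)\le\lambda_0,\qquad 0<\xi\le\min\{\xi_0,p\},$$ and that the following conditions hold. (i) $\Gamma$ is $(\Delta,\theta,\xi,C)$-conflict-good at scale $M$. (ii) Every pair $(V_i,V_j)$ with $i\ne j$ is $(\varepsilon_0,d,p)$-lower-regular in $G$. (iii) $G\subseteq\Gamma$ is $(\Delta,\theta,\boldsymbol\varepsilon,\boldsymbol\eta,d,p)$-envelope-positively inheriting at scale $M$. Then there exists a part-respecting injective map $\phi:V(H)\to V(\Gamma)$ which is an acceptable embedding.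
   Context: All graphs are finite and simple; $\log$ is the natural logarithm. A $k$-partite graph with parts $V_1,\dots,V_k$ has vertex set the disjoint union of the $V_i$ and no edges inside any part. For a graph $F$ and disjoint vertex sets $X,Y$, $e_F(X,Y)$ is the number of edges of $F$ with one end in $X$ and one in $Y$. For a vertex $v$ and set $X$, $N_F(v;X)=N_F(v)\cap X$; for a set $W$ of vertices, $N_F(W;X)=X\cap\bigcap_{w\in W}N_F(w)$, with $N_F(\varnothing;X)=X$. Embeddings. For graphs $G\subseteq\Gamma$ on the same vertex set, an injective map $\phi:V(H)\to V(\Gamma)$ is acceptable if for all distinct $x,y\in V(H)$: $xy\in E(H)$ implies $\phi(x)\phi(y)\in E(G)$, and $xy\notin E(H)$ implies $\phi(x)\phi(y)\notin E(\Gamma)$. An assignment $\chi:V(H)\to[k]$ is proper if $\chi(x)\ne\chi(y)$ whenever $xy\in E(H)$. The map $\phi$ is part-respecting if $\phi(x)\in V_{\chi(x)}$ for every $x\in V(H)$. A set $B\subseteq V(H)$ is a separated buffer if distinct vertices of $B$ are at distance at least three in $H$. Lower-regularity. A disjoint pair $(X,Y)$ is $(\varepsilon,d,p)$-lower-regular in $G$ if all $X'\subseteq X$, $Y'\subseteq Y$ with $|X'|\ge\varepsilon|X|$ and $|Y'|\ge\varepsilon|Y|$ satisfy $e_G(X',Y')\ge(d-\varepsilon)p|X'||Y'|$. Candidate-scale sets. Let $\Gamma$ be $k$-partite with parts $V_1,\dots,V_k$, each of order comparable to $M$ (here $M\le|V_i|\le\kappa M$), with $p$ fixed as in the claim. For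 $0<\theta\le1$, a set $S\subseteq V_i$ is a $(\Delta,\theta)$-candidate-scale set (candidate-scale set for short) with witness $W$ if $W\subseteq V(\Gamma)\setminus V_i$, $|W|\le\Delta$, $S\subseteq N_\Gamma(W;V_i)$ and $|S|\ge\theta p^{|W|}|V_i|$. A set is candidate-scale if it is so with some witness. Conflict-goodness. $\Gamma$ is $(\Delta,\theta,\xi,C)$-conflict-good at scale $M$ if both of the following hold. (a) If $S\subseteq N_\Gamma(W;V_i)$ and $S'\subseteq N_\Gamma(W';V_j)$ are candidate-scale sets (with witnesses $W,W'$) in distinct parts, then $e_\Gamma(S,S')\le C(p+\xi)|S||S'|$. (b) Let $x$ be a label with part $i\in[k]$, and let $Y$ be a finite set of labels with a part map $\chi:Y\to[k]$. Let $W_x$ and $W_y$ ($y\in Y$) be witness sets of size at most $\Delta$ such that each vertex appears in at most $\Delta$ of the sets $W_y$. If $S_x\subseteq N_\Gamma(W_x;V_i)$ and $S_y\subseteq N_\Gamma(W_y;V_{\chi(y)})$ are candidate-scale sets with these witnesses, then for all non-negative weights $(\omega_y)_{y\in Y}$, $$\sum_{y\in Y,\ \chi(y)=i}\omega_y\frac{|S_x\cap S_y|}{|S_x||S_y|}\le\xi\sum_{y\in Y,\ \chi(y)=i}\omega_y .$$ Envelope-positive inheritance. $G\subseteq\Gamma$ is $(\Delta,\theta,\boldsymbol\varepsilon,\boldsymbol\eta,d,p)$-envelope-positively inheriting at scale $M$ if the following hold whenever $0\le h<2\Delta$ and $S_i\subseteq V_i$, $S_j\subseteq V_j$, $S_\ell\subseteq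 V_\ell$ are $(\Delta,\theta)$-candidate-scale sets (in $\Gamma$). First, if $i\ne j$ and $(S_i,S_j)$ is $(\varepsilon_h,d,p)$-lower-regular in $G$, then all but at most $\varepsilon_h|S_i|$ vertices $v\in S_i$ satisfy $|N_G(v;S_j)|\ge\frac d2p|S_j|$. Second, if $i\ne j$, $j\ne\ell$ (with $i=\ell$ allowed) and $(S_j,S_\ell)$ is $(\varepsilon_h,d,p)$-lower-regular in $G$, then for all but at most $\varepsilon_h|S_i|$ vertices $v\in S_i$ the pair $(N_\Gamma(v;S_j),S_\ell)$ is $(\eta_h,d,p)$-lower-regular in $G$. Third, if $i,j,\ell$ are distinct and $(S_j,S_\ell)$ is $(\varepsilon_h,d,p)$-lower-regular in $G$, then for all but at most $\varepsilon_h|S_i|$ vertices $v\in S_i$ the pair $(N_\Gamma(v;S_j),N_\Gamma(v;S_\ell))$ is $(\eta_h,d,p)$-lower-regular in $G$. *)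

theory Defs
  imports Complex_Main "HOL-Library.Disjoint_Sets"
    "Graph_Theory.Digraph_Component" "Graph_Theory.Pair_Digraph" "Graph_Theory.Shortest_Path"
begin

text \<open>
  Finite simple graphs are the objects satisfying \<^locale>\<open>pair_graph\<close>: finite symmetric loop-free
  digraphs whose arcs are pairs of vertices, an edge being a pair of opposite arcs. Parts are
  indexed by \<open>{1..k}\<close>; values of \<open>V\<close> at other indices are irrelevant.
\<close>

definition k_partite :: "nat \<Rightarrow> (nat \<Rightarrow> 'v set) \<Rightarrow> 'v pair_pre_digraph \<Rightarrow> bool" where
  "k_partite k V F \<longleftrightarrow>
     pair_graph F \<and> pverts F = (\<Union>i\<in>{1..k}. V i) \<and> disjoint_family_on V {1..k} \<and>
     (\<forall>i\<in>{1..k}. parcs F \<inter> V i \<times> V i = {})"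

text \<open>
  Only used for disjoint \<open>X\<close> and \<open>Y\<close>, where each edge between them has exactly one of its
  two arcs in \<open>X \<times> Y\<close>.
\<close>
definition edges_between :: "'v pair_pre_digraph \<Rightarrow> 'v set \<Rightarrow> 'v set \<Rightarrow> nat" where
  "edges_between F X Y = card (parcs F \<inter> X \<times> Y)"

definition nbhd :: "'v pair_pre_digraph \<Rightarrow> 'v \<Rightarrow> 'v set" where
  "nbhd F v = {u. (v, u) \<in> parcs F}"

definition nbhd_in :: "'v pair_pre_digraph \<Rightarrow> 'v \<Rightarrow> 'v set \<Rightarrow> 'v set" where
  "nbhd_in F v X = nbhd F v \<inter> X"

definition common_nbhd_in :: "'v pair_pre_digraph \<Rightarrow> 'v set \<Rightarrow> 'v set \<Rightarrow> 'v set" where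
  "common_nbhd_in F W X = X \<inter> (\<Inter>w\<in>W. nbhd F w)"

definition max_degree_le :: "'h pair_pre_digraph \<Rightarrow> nat \<Rightarrow> bool" where
  "max_degree_le H \<Delta> \<longleftrightarrow> (\<forall>x\<in>pverts H. out_degree (with_proj H) x \<le> \<Delta>)"

definition proper_assignment :: "'h pair_pre_digraph \<Rightarrow> nat \<Rightarrow> ('h \<Rightarrow> nat) \<Rightarrow> bool" where
  "proper_assignment H k \<chi> \<longleftrightarrow>
     (\<forall>x\<in>pverts H. \<chi> x \<in> {1..k}) \<and> (\<forall>(x, y)\<in>parcs H. \<chi> x \<noteq> \<chi> y)"

text \<open>
  With unit weights, \<open>wf_digraph.\<mu>\<close> is the graph distance, with value \<open>\<infinity>\<close> between different
  components.
\<close>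
definition separated_buffer :: "'h pair_pre_digraph \<Rightarrow> 'h set \<Rightarrow> bool" where
  "separated_buffer H B \<longleftrightarrow>
     B \<subseteq> pverts H \<and>
     (\<forall>x\<in>B. \<forall>y\<in>B. x \<noteq> y \<longrightarrow> wf_digraph.\<mu> (with_proj H) (\<lambda>_. 1) x y \<ge> 3)"

definition acceptable_embedding ::
    "'h pair_pre_digraph \<Rightarrow> 'v pair_pre_digraph \<Rightarrow> 'v pair_pre_digraph \<Rightarrow> ('h \<Rightarrow> 'v) \<Rightarrow> bool" where
  "acceptable_embedding H G \<Gamma> \<phi> \<longleftrightarrow>
     inj_on \<phi> (pverts H) \<and> \<phi> ` pverts H \<subseteq> pverts \<Gamma> \<and>
     (\<forall>x\<in>pverts H. \<forall>y\<in>pverts H. x \<noteq> y \<longrightarrow>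
        ((x, y) \<in> parcs H \<longrightarrow> (\<phi> x, \<phi> y) \<in> parcs G) \<and>
        ((x, y) \<notin> parcs H \<longrightarrow> (\<phi> x, \<phi> y) \<notin> parcs \<Gamma>))"

definition part_respecting ::
    "'h pair_pre_digraph \<Rightarrow> ('h \<Rightarrow> nat) \<Rightarrow> (nat \<Rightarrow> 'v set) \<Rightarrow> ('h \<Rightarrow> 'v) \<Rightarrow> bool" where
  "part_respecting H \<chi> V \<phi> \<longleftrightarrow> (\<forall>x\<in>pverts H. \<phi> x \<in> V (\<chi> x))"

definition lower_regular ::
    "'v pair_pre_digraph \<Rightarrow> real \<Rightarrow> real \<Rightarrow> real \<Rightarrow> 'v set \<Rightarrow> 'v set \<Rightarrow> bool" where
  "lower_regular G \<epsilon> d p X Y \<longleftrightarrow>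
     X \<inter> Y = {} \<and>
     (\<forall>X' Y'. X' \<subseteq> X \<longrightarrow> Y' \<subseteq> Y \<longrightarrow>
        real (card X') \<ge> \<epsilon> * real (card X) \<longrightarrow> real (card Y') \<ge> \<epsilon> * real (card Y) \<longrightarrow>
        real (edges_between G X' Y') \<ge> (d - \<epsilon>) * p * real (card X') * real (card Y'))"

definition candidate_scale_with ::
    "'v pair_pre_digraph \<Rightarrow> (nat \<Rightarrow> 'v set) \<Rightarrow> real \<Rightarrow> nat \<Rightarrow> real \<Rightarrow> nat \<Rightarrow> 'v set \<Rightarrow> 'v set \<Rightarrow> bool" where
  "candidate_scale_with \<Gamma> V p \<Delta> \<theta> i S W \<longleftrightarrow>
     W \<subseteq> pverts \<Gamma> - V i \<and> card W \<le> \<Delta> \<and> S \<subseteq> common_nbhd_in \<Gamma> W (V i) \<and>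
     real (card S) \<ge> \<theta> * p ^ card W * real (card (V i))"

definition candidate_scale ::
    "'v pair_pre_digraph \<Rightarrow> (nat \<Rightarrow> 'v set) \<Rightarrow> real \<Rightarrow> nat \<Rightarrow> real \<Rightarrow> nat \<Rightarrow> 'v set \<Rightarrow> bool" where
  "candidate_scale \<Gamma> V p \<Delta> \<theta> i S \<longleftrightarrow> (\<exists>W. candidate_scale_with \<Gamma> V p \<Delta> \<theta> i S W)"

text \<open>
  The scale \<open>M\<close> only names the standing assumption \<open>M \<le> |V\<^sub>i| \<le> \<kappa> M\<close> on the parts, so it is
  not a parameter here or in \<open>envelope_positively_inheriting\<close> below. In the second part, labels
  are natural numbers, which covers every finite family; the label \<open>x\<close> enters only through
  its part \<open>i\<close> and the sets \<open>W\<^sub>x\<close>, \<open>S\<^sub>x\<close>.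
\<close>
definition conflict_good ::
    "'v pair_pre_digraph \<Rightarrow> nat \<Rightarrow> (nat \<Rightarrow> 'v set) \<Rightarrow> real \<Rightarrow> nat \<Rightarrow> real \<Rightarrow> real \<Rightarrow> real \<Rightarrow> bool" where
  "conflict_good \<Gamma> k V p \<Delta> \<theta> \<xi> C \<longleftrightarrow>
     (\<forall>i\<in>{1..k}. \<forall>j\<in>{1..k}. \<forall>S S'.
        i \<noteq> j \<longrightarrow> candidate_scale \<Gamma> V p \<Delta> \<theta> i S \<longrightarrow> candidate_scale \<Gamma> V p \<Delta> \<theta> j S' \<longrightarrow>
        real (edges_between \<Gamma> S S') \<le> C * (p + \<xi>) * real (card S) * real (card S')) \<and>
     (\<forall>i\<in>{1..k}. \<forall>Sx Wx. \<forall>(Y :: nat set) (\<chi> :: nat \<Rightarrow> nat)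
         (S :: nat \<Rightarrow> 'v set) (W :: nat \<Rightarrow> 'v set) (\<omega> :: nat \<Rightarrow> real).
        finite Y \<longrightarrow>
        (\<forall>y\<in>Y. \<chi> y \<in> {1..k}) \<longrightarrow>
        (\<forall>v. card {y \<in> Y. v \<in> W y} \<le> \<Delta>) \<longrightarrow>
        candidate_scale_with \<Gamma> V p \<Delta> \<theta> i Sx Wx \<longrightarrow>
        (\<forall>y\<in>Y. candidate_scale_with \<Gamma> V p \<Delta> \<theta> (\<chi> y) (S y) (W y)) \<longrightarrow>
        (\<forall>y\<in>Y. \<omega> y \<ge> 0) \<longrightarrow>
        (\<Sum>y\<in>{y \<in> Y. \<chi> y = i}.
           \<omega> y * (real (card (Sx \<inter> S y)) / (real (card Sx) * real (card (S y)))))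
        \<le> \<xi> * (\<Sum>y\<in>{y \<in> Y. \<chi> y = i}. \<omega> y))"

text \<open>
  For \<open>i = l\<close> the sets \<open>Si\<close> and \<open>Sl\<close> may be different subsets of the same part.
\<close>
definition envelope_positively_inheriting ::
    "'v pair_pre_digraph \<Rightarrow> 'v pair_pre_digraph \<Rightarrow> nat \<Rightarrow> (nat \<Rightarrow> 'v set) \<Rightarrow> nat \<Rightarrow> real \<Rightarrow>
     (nat \<Rightarrow> real) \<Rightarrow> (nat \<Rightarrow> real) \<Rightarrow> real \<Rightarrow> real \<Rightarrow> bool" where
  "envelope_positively_inheriting G \<Gamma> k V \<Delta> \<theta> \<epsilon> \<eta> d p \<longleftrightarrow>
     (\<forall>h<2 * \<Delta>. \<forall>i\<in>{1..k}. \<forall>j\<in>{1..k}. \<forall>l\<in>{1..k}. \<forall>Si Sj Sl.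
        candidate_scale \<Gamma> V p \<Delta> \<theta> i Si \<longrightarrow> candidate_scale \<Gamma> V p \<Delta> \<theta> j Sj \<longrightarrow>
        candidate_scale \<Gamma> V p \<Delta> \<theta> l Sl \<longrightarrow>
        (i \<noteq> j \<and> lower_regular G (\<epsilon> h) d p Si Sj \<longrightarrow>
           real (card {v \<in> Si. \<not> real (card (nbhd_in G v Sj)) \<ge> d / 2 * p * real (card Sj)})
             \<le> \<epsilon> h * real (card Si)) \<and>
        (i \<noteq> j \<and> j \<noteq> l \<and> lower_regular G (\<epsilon> h) d p Sj Sl \<longrightarrow>
           real (card {v \<in> Si. \<not> lower_regular G (\<eta> h) d p (nbhd_in \<Gamma> v Sj) Sl})
             \<le> \<epsilon> h * real (card Si)) \<and>
        (i \<noteq> j \<and> j \<noteq> l \<and> i \<noteq> l \<and> lower_regular G (\<epsilon> h) d p Sj Sl \<longrightarrow>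
           real (card {v \<in> Si. \<not> lower_regular G (\<eta> h) d p (nbhd_in \<Gamma> v Sj) (nbhd_in \<Gamma> v Sl)})
             \<le> \<epsilon> h * real (card Si)))"

end

theory Submission
  imports Defs
begin

text \<open>
  The vertices of \<open>H\<close> are embedded one at a time, in an arbitrary order. Every unembedded \<open>y\<close>
  carries a set \<open>S y\<close> of images that are compatible with everything placed so far. When \<open>x\<close>
  receives the image \<open>v\<close>, the set of a neighbour \<open>y\<close> of \<open>x\<close> is cut down to the \<open>G\<close>-neighbours
  of \<open>v\<close>, and the set of a non-neighbour loses its clash with \<open>v\<close>: the vertex \<open>v\<close> itself and
  the \<open>\<Gamma>\<close>-neighbours of \<open>v\<close>. Any choice made in this way yields an acceptable embedding, provided
  the sets never become empty; the work is to choose \<open>v\<close> so that they stay candidate-scale.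

  A vertex \<open>y\<close> is cut down by neighbours at most \<open>\<Delta>\<close> times. Inheritance makes all but a small
  fraction of the choices of \<open>v\<close> keep a \<open>(d/2)p\<close> share and pass lower-regularity on to the new
  pairs. Inheritance speaks about \<open>\<Gamma>\<close>-neighbourhoods; part (a) of conflict-goodness bounds
  \<open>\<Gamma>\<close>-degrees on average, so for most \<open>v\<close> the \<open>G\<close>-neighbourhood is a constant share of the
  \<open>\<Gamma>\<close>-neighbourhood, and regularity survives with a constant factor.

  Clashes can happen in all of the \<open>n\<close> steps. Conflict-goodness says that on average over \<open>v\<close> a
  set loses at most a share \<open>\<mu> = C(p + \<xi>)\<close> in one step: part (a) covers sets in different parts,
  and part (b), applied to a single label, covers sets in the same part. Two estimates turn this
  average into a bound for all vertices at once. Let \<open>s\<close> be of order \<open>log(2n)\<close>, so that the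
  sparsity hypothesis makes \<open>s \<mu> n\<close> a small constant.

  \<^item> By Markov's inequality and a union bound over \<open>y\<close>, all but a quarter of the \<open>v\<close> cost every
    set at most a share \<open>1/(2s)\<close> (\<open>few_large_clash\<close>, \<open>half_good\<close>).
  \<^item> Let \<open>D y\<close> be the share of \<open>S y\<close> that has survived clashes. As single losses are below
    \<open>1/(2s)\<close>, a loss of share \<open>l\<close> multiplies \<open>D y ^ (- s)\<close> by at most \<open>1 + 2 s l\<close>
    (\<open>inverse_power_step\<close>). Choosing \<open>v\<close> no worse than average makes the sum of \<open>D y ^ (- s)\<close>
    over all \<open>y\<close> grow by at most \<open>1 + 4 s \<mu>\<close> per step (\<open>potential_step\<close>), so it never exceeds
    \<open>3 n\<close>, and \<open>3 n \<le> 2 ^ s\<close> gives \<open>D y \<ge> 1/2\<close> for every \<open>y\<close> (\<open>retention_ge_half\<close>).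

  This is the method of conditional expectations applied to an exponential-moment bound.
\<close>

text \<open>
  The ratio \<open>\<theta>\<close>: up to \<open>\<Delta>\<close> embedded neighbours each leave at least a share \<open>(d/2)p\<close> of a candidate
  set, and all clashes together leave at least one half.
\<close>
definition candidate_ratio :: "real \<Rightarrow> nat \<Rightarrow> real" where
  "candidate_ratio d \<Delta> = (d / 2) ^ \<Delta> / 2"

text \<open>
  One step has to avoid at most \<open>\<Delta> + \<Delta>\<^sup>2\<close> exceptional sets of this relative size; together they
  cover at most an eighth of the candidates.
\<close>
definition tolerance :: "nat \<Rightarrow> real" where
  "tolerance \<Delta> = 1 / (16 * (real \<Delta>)\<^sup>2)"

text \<open>
  The guaranteed \<open>G\<close>-degree \<open>(d/2)p|S|\<close> divided by the tolerated \<open>\<Gamma>\<close>-degree \<open>16\<Delta>Cp|S|\<close>. A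
  regularity parameter gets divided by this ratio when a \<open>\<Gamma>\<close>-neighbourhood is replaced by a
  \<open>G\<close>-neighbourhood.
\<close>
definition nbhd_fraction :: "real \<Rightarrow> real \<Rightarrow> nat \<Rightarrow> real" where
  "nbhd_fraction d C \<Delta> = d / (32 * C * real \<Delta>)"

text \<open>
  Images that a non-neighbour loses once \<open>v\<close> is used. Including \<open>v\<close> itself makes injectivity a
  special case of induced non-adjacency.
\<close>
definition clash :: "'v pair_pre_digraph \<Rightarrow> 'v \<Rightarrow> 'v set \<Rightarrow> 'v set" where
  "clash \<Gamma> v T = {u \<in> T. u = v \<or> (v, u) \<in> parcs \<Gamma>}"

definition fits :: "'h pair_pre_digraph \<Rightarrow> 'v pair_pre_digraph \<Rightarrow> 'v pair_pre_digraph \<Rightarrow>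
    'h \<Rightarrow> 'h \<Rightarrow> 'v \<Rightarrow> 'v \<Rightarrow> bool" where
  "fits H G \<Gamma> x y u v \<longleftrightarrow>
     u \<noteq> v \<and> ((x, y) \<in> parcs H \<longrightarrow> (u, v) \<in> parcs G) \<and> ((x, y) \<notin> parcs H \<longrightarrow> (u, v) \<notin> parcs \<Gamma>)"

section \<open>Finite averaging\<close>

lemma card_above_le:
  fixes f :: "'a \<Rightarrow> real"
  assumes "finite S" "\<And>v. v \<in> S \<Longrightarrow> 0 \<le> f v" "sum f S \<le> c"
  shows "t * real (card {v \<in> S. t < f v}) \<le> c"
proof -
  have "t * real (card {v \<in> S. t < f v}) = (\<Sum>v\<in>{v \<in> S. t < f v}. t)" by simp
  also have "\<dots> \<le> (\<Sum>v\<in>{v \<in> S. t < f v}. f v)" by (rule sum_mono) auto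
  also have "\<dots> \<le> sum f S" using assms by (intro sum_mono2) auto
  finally show ?thesis using assms(3) by linarith
qed

lemma exists_le_average:
  fixes f :: "'a \<Rightarrow> real"
  assumes "finite T" "T \<noteq> {}" "sum f T \<le> b * real (card T)"
  shows "\<exists>v\<in>T. f v \<le> b"
proof (rule ccontr)
  assume "\<not> ?thesis"
  then have "(\<Sum>v\<in>T. b) < sum f T" using assms by (intro sum_strict_mono) auto
  then show False using assms by (simp add: mult.commute)
qed

lemma card_UN_le_mult:
  assumes "finite I" "\<And>i. i \<in> I \<Longrightarrow> real (card (B i)) \<le> c" "real (card I) \<le> m" "0 \<le> c"
  shows "real (card (\<Union>i\<in>I. B i)) \<le> m * c"
proof -
  have "real (card (\<Union>i\<in>I. B i)) \<le> (\<Sum>i\<in>I. real (card (B i)))"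
    using card_UN_le[OF assms(1), of B] by (metis of_nat_le_iff of_nat_sum)
  also have "\<dots> \<le> real (card I) * c"
    using sum_bounded_above[of I "\<lambda>i. real (card (B i))" c] assms by simp
  also have "\<dots> \<le> m * c" using assms by (intro mult_right_mono) auto
  finally show ?thesis .
qed

text \<open>
  Bernoulli's inequality turns a loss of share \<open>l\<close> into a factor that is linear in \<open>l\<close>. Linearity
  is what allows the potential to be averaged over the choice of an image.
\<close>
lemma inverse_power_step:
  fixes l :: real
  assumes "0 \<le> l" "2 * real s * l \<le> 1" "s \<ge> 1"
  shows "(1 / (1 - l)) ^ s \<le> 1 + 2 * real s * l"
proof -
  have "1 * l \<le> real s * l" using assms by (intro mult_right_mono) auto
  then have l: "l \<le> 1/2" using assms by linarith
  have "1 + real s * (- l) \<le> (1 + (- l)) ^ s" using l by (intro Bernoulli_inequality) auto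
  then have b: "1 - real s * l \<le> (1 - l) ^ s" by simp
  define t where "t = real s * l"
  have t: "0 \<le> t" "2 * t \<le> 1" using assms by (auto simp: t_def)
  have "1 = (1 - l) ^ s * (1 / (1 - l)) ^ s" using l by (simp add: power_one_over)
  have "(1 / (1 - l)) ^ s = 1 / (1 - l) ^ s" by (simp add: power_one_over)
  also have "\<dots> \<le> 1 / (1 - t)" using b t l by (intro divide_left_mono mult_pos_pos) (auto simp: t_def)
  also have "\<dots> \<le> 1 + 2 * t"
  proof -
    have "0 \<le> t * (1 - 2 * t)" using t by (intro mult_nonneg_nonneg) auto
    then have "1 \<le> (1 + 2 * t) * (1 - t)" by (simp add: algebra_simps)
    then show ?thesis using t by (simp add: divide_le_eq)
  qed
  finally show ?thesis by (simp add: t_def mult.assoc)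
qed

section \<open>Edge counts and lower-regularity\<close>

lemma edges_between_eq_sum:
  assumes "finite X" "finite Y"
  shows "edges_between F X Y = (\<Sum>v\<in>X. card (nbhd_in F v Y))"
proof -
  have "parcs F \<inter> X \<times> Y = (SIGMA v:X. nbhd_in F v Y)"
    by (auto simp: nbhd_in_def nbhd_def)
  then show ?thesis using assms by (simp add: edges_between_def nbhd_in_def)
qed

lemma pair_graph_arc_sym: "pair_graph F \<Longrightarrow> (u, v) \<in> parcs F \<Longrightarrow> (v, u) \<in> parcs F"
  using pair_sym_digraph.pair_sym_arcs[of F]
  by (simp add: pair_graph_def pair_pseudo_graph_def symmetric_def symD)

lemma pair_graph_no_loop: "pair_graph F \<Longrightarrow> (v, v) \<notin> parcs F"
  using pair_loopfree_digraph.pair_no_loops[of F "(v, v)"]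
  by (auto simp: pair_graph_def pair_digraph_def)

lemma pair_graph_arc_verts:
  assumes "pair_graph F" "(u, v) \<in> parcs F" shows "u \<in> pverts F" "v \<in> pverts F"
proof -
  have "pair_wf_digraph F"
    using assms(1) by (simp add: pair_graph_def pair_digraph_def pair_loopfree_digraph_def)
  then show "u \<in> pverts F" "v \<in> pverts F"
    using assms(2) pair_wf_digraph.in_arcsD1 pair_wf_digraph.in_arcsD2 by metis+
qed

lemma pair_graph_finite: "pair_graph F \<Longrightarrow> finite (pverts F)"
  by (simp add: pair_graph_def pair_digraph_def pair_fin_digraph.pair_finite_verts)

lemma edges_between_commute:
  assumes "pair_graph F" shows "edges_between F X Y = edges_between F Y X"
proof -
  have "prod.swap ` (parcs F \<inter> X \<times> Y) = parcs F \<inter> Y \<times> X"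
    using pair_graph_arc_sym[OF assms] by (force simp: image_iff)
  moreover have "card (prod.swap ` (parcs F \<inter> X \<times> Y)) = card (parcs F \<inter> X \<times> Y)"
    by (rule card_image) (auto simp: inj_on_def)
  ultimately show ?thesis by (simp add: edges_between_def)
qed

lemma lower_regular_commute:
  assumes "pair_graph F" "lower_regular F e d p X Y" shows "lower_regular F e d p Y X"
  unfolding lower_regular_def
proof (intro conjI allI impI)
  show "Y \<inter> X = {}" using assms(2) by (auto simp: lower_regular_def)
  fix Y' X' assume "Y' \<subseteq> Y" "X' \<subseteq> X"
    "real (card Y') \<ge> e * real (card Y)" "real (card X') \<ge> e * real (card X)"
  then have "(d - e) * p * real (card X') * real (card Y') \<le> real (edges_between F X' Y')"
    using assms(2) unfolding lower_regular_def by blast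
  then show "(d - e) * p * real (card Y') * real (card X') \<le> real (edges_between F Y' X')"
    by (simp add: edges_between_commute[OF assms(1), of Y' X'] mult_ac)
qed

text \<open>
  Subsets that qualify as large for the new parameter have to be large for the old one. Stating
  this as an inequality between absolute sizes, separately for each side, covers clashes and
  passages to neighbourhoods alike.
\<close>
lemma lower_regular_subset:
  assumes "lower_regular F e d p X Y" "X0 \<subseteq> X" "Y0 \<subseteq> Y" "e \<le> e'" "0 \<le> p"
    and X: "e * real (card X) \<le> e' * real (card X0)"
    and Y: "e * real (card Y) \<le> e' * real (card Y0)"
  shows "lower_regular F e' d p X0 Y0"
  unfolding lower_regular_def
proof (intro conjI allI impI)
  show "X0 \<inter> Y0 = {}" using assms unfolding lower_regular_def by blast
  fix X' Y' assume a: "X' \<subseteq> X0" "Y' \<subseteq> Y0"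
    "real (card X') \<ge> e' * real (card X0)" "real (card Y') \<ge> e' * real (card Y0)"
  have "X' \<subseteq> X" "Y' \<subseteq> Y" "real (card X') \<ge> e * real (card X)" "real (card Y') \<ge> e * real (card Y)"
    using a assms by auto
  then have "(d - e) * p * real (card X') * real (card Y') \<le> real (edges_between F X' Y')"
    using assms(1) unfolding lower_regular_def by blast
  moreover have "(d - e') * p * real (card X') * real (card Y') \<le> (d - e) * p * real (card X') * real (card Y')"
    using assms by (intro mult_right_mono) auto
  ultimately show "(d - e') * p * real (card X') * real (card Y') \<le> real (edges_between F X' Y')"
    by linarith
qed

lemma max_degree_le_card:
  assumes "max_degree_le H \<Delta>" "x \<in> pverts H"
  shows "card {y. (x, y) \<in> parcs H} \<le> \<Delta>"
proof -
  have "out_arcs (with_proj H) x = Pair x ` {y. (x, y) \<in> parcs H}"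
    by (auto simp: out_arcs_def)
  moreover have "card (Pair x ` {y. (x, y) \<in> parcs H}) = card {y. (x, y) \<in> parcs H}"
    by (intro card_image inj_onI) auto
  moreover have "card (out_arcs (with_proj H) x) \<le> \<Delta>"
    using assms by (simp add: max_degree_le_def out_degree_def)
  ultimately show ?thesis by simp
qed

section \<open>Partial embeddings with candidate sets\<close>

text \<open>
  The exponent \<open>s\<close> of the potential is kept as a parameter: it has to be small enough for the
  expected clashes to be harmless at scale \<open>1/s\<close>, and large enough for \<open>2 ^ s\<close> to beat a sum over
  all vertices of \<open>H\<close>.
\<close>
locale embedding_setting =
  fixes G \<Gamma> :: "'v pair_pre_digraph" and k :: nat and V :: "nat \<Rightarrow> 'v set"
    and H :: "'h pair_pre_digraph" and \<chi> :: "'h \<Rightarrow> nat" and \<Delta> :: nat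
    and d C p \<xi> :: real and \<epsilon> \<eta> :: "nat \<Rightarrow> real" and s :: nat
  assumes G: "k_partite k V G" and \<Gamma>: "k_partite k V \<Gamma>" and sub: "parcs G \<subseteq> parcs \<Gamma>"
    and V_pos: "\<And>i. i \<in> {1..k} \<Longrightarrow> 0 < card (V i)"
    and ranges: "\<Delta> \<ge> 1" "0 < d" "d \<le> 1" "C \<ge> 1" "0 < p" "0 < \<xi>" "\<xi> \<le> p" "s \<ge> 1"
    and H: "pair_graph H" "max_degree_le H \<Delta>" "proper_assignment H k \<chi>"
    and few_clashes: "8 * real s * (C * (p + \<xi>)) * real (card (pverts H)) \<le> 1"
    and s_large: "3 * real (card (pverts H)) \<le> 2 ^ s"
    and good: "conflict_good \<Gamma> k V p \<Delta> (candidate_ratio d \<Delta>) \<xi> C"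
    and inherit: "envelope_positively_inheriting G \<Gamma> k V \<Delta> (candidate_ratio d \<Delta>) \<epsilon> \<eta> d p"
    and \<epsilon>1: "\<epsilon> 1 = tolerance \<Delta>" and \<eta>1: "\<eta> 1 = nbhd_fraction d C \<Delta> * (tolerance \<Delta> / 4)"
    and regular: "\<And>i j. i \<in> {1..k} \<Longrightarrow> j \<in> {1..k} \<Longrightarrow> i \<noteq> j \<Longrightarrow>
      lower_regular G (tolerance \<Delta> / 4) d p (V i) (V j)"
begin

definition placed_nbrs :: "'h set \<Rightarrow> 'h \<Rightarrow> 'h set" where
  "placed_nbrs A y = {x \<in> A. (x, y) \<in> parcs H}"

definition clash_rate :: real where "clash_rate = C * (p + \<xi>)"

definition potential :: "'h set \<Rightarrow> ('h \<Rightarrow> real) \<Rightarrow> real" where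
  "potential A D = (\<Sum>y\<in>pverts H - A. (1 / D y) ^ s)"

text \<open>
  Invariant after the vertices in \<open>A\<close> have been embedded by \<open>\<phi>\<close>. The retention \<open>D y\<close> is the share
  of \<open>S y\<close> that survived clashes; separating it from the neighbour shares \<open>(d/2)p\<close> lets the
  potential control it globally. Dividing the regularity parameter by \<open>D y * D z\<close> pays for the
  clashes of both sets, whereas inheritance starts a pair afresh whenever a neighbour cuts it.
  Retentions of at least one half keep the parameter at or below \<open>tolerance\<close>.
\<close>
definition state :: "'h set \<Rightarrow> ('h \<Rightarrow> 'v) \<Rightarrow> ('h \<Rightarrow> 'v set) \<Rightarrow> ('h \<Rightarrow> real) \<Rightarrow> bool" where
  "state A \<phi> S D \<longleftrightarrow>
     A \<subseteq> pverts H \<and> (\<forall>x\<in>A. \<phi> x \<in> V (\<chi> x)) \<and>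
     (\<forall>x\<in>A. \<forall>y\<in>A. x \<noteq> y \<longrightarrow> fits H G \<Gamma> x y (\<phi> x) (\<phi> y)) \<and>
     (\<forall>y\<in>pverts H - A. S y \<subseteq> V (\<chi> y) \<and> (\<forall>x\<in>A. \<forall>u\<in>S y. fits H G \<Gamma> x y (\<phi> x) u) \<and>
        0 < D y \<and> D y \<le> 1 \<and>
        D y * (d / 2 * p) ^ card (placed_nbrs A y) * real (card (V (\<chi> y))) \<le> real (card (S y))) \<and>
     (\<forall>y\<in>pverts H - A. \<forall>z\<in>pverts H - A. (y, z) \<in> parcs H \<longrightarrow>
        lower_regular G (tolerance \<Delta> / 4 / (D y * D z)) d p (S y) (S z)) \<and>
     potential A D \<le> real (card (pverts H)) * (1 + 4 * real s * clash_rate) ^ card A"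

lemma finite_H: "finite (pverts H)"
  using H(1) by (rule pair_graph_finite)

lemma graphs: "pair_graph G" "pair_graph \<Gamma>"
  using G \<Gamma> by (auto simp: k_partite_def)

lemma part_mem: "x \<in> pverts H \<Longrightarrow> \<chi> x \<in> {1..k}"
  using H(3) by (auto simp: proper_assignment_def)

lemma part_neq: "(x, y) \<in> parcs H \<Longrightarrow> \<chi> x \<noteq> \<chi> y"
  using H(3) by (auto simp: proper_assignment_def)

lemma parts_disjoint: "i \<in> {1..k} \<Longrightarrow> j \<in> {1..k} \<Longrightarrow> i \<noteq> j \<Longrightarrow> V i \<inter> V j = {}"
  using G by (auto simp: k_partite_def disjoint_family_on_def)

lemma tolerance_pos: "0 < tolerance \<Delta>"
  using ranges by (simp add: tolerance_def)

lemma nbhd_fraction_bounds: "0 < nbhd_fraction d C \<Delta>" "nbhd_fraction d C \<Delta> \<le> 1"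
proof -
  show "0 < nbhd_fraction d C \<Delta>" using ranges by (simp add: nbhd_fraction_def)
  have "1 * 1 \<le> C * real \<Delta>" using ranges by (intro mult_mono) auto
  then show "nbhd_fraction d C \<Delta> \<le> 1" using ranges by (simp add: nbhd_fraction_def divide_le_eq)
qed

lemma clash_rate_pos: "0 < clash_rate"
  using ranges by (simp add: clash_rate_def)

lemma fits_commute: "fits H G \<Gamma> x y u v = fits H G \<Gamma> y x v u"
  unfolding fits_def using pair_graph_arc_sym graphs H(1) by metis

lemma card_nbrs: "x \<in> pverts H \<Longrightarrow> card {y. (x, y) \<in> parcs H} \<le> \<Delta>"
  by (rule max_degree_le_card[OF H(2)])

lemma finite_nbrs: "finite {y. (x, y) \<in> parcs H}"
  by (rule finite_subset[OF _ finite_H]) (use pair_graph_arc_verts[OF H(1)] in auto)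

lemma stateD:
  assumes "state A \<phi> S D" "y \<in> pverts H - A"
  shows "S y \<subseteq> V (\<chi> y)" "\<And>x u. x \<in> A \<Longrightarrow> u \<in> S y \<Longrightarrow> fits H G \<Gamma> x y (\<phi> x) u"
    "0 < D y" "D y \<le> 1"
    "D y * (d / 2 * p) ^ card (placed_nbrs A y) * real (card (V (\<chi> y))) \<le> real (card (S y))"
    "\<And>z. z \<in> pverts H - A \<Longrightarrow> (y, z) \<in> parcs H \<Longrightarrow>
      lower_regular G (tolerance \<Delta> / 4 / (D y * D z)) d p (S y) (S z)"
  using assms unfolding state_def by blast+

text \<open>
  A single summand of the potential is at most \<open>n (1 + 4 s \<mu>) ^ n \<le> e n \<le> 2 ^ s\<close>, and the
  \<open>s\<close>-th root is taken.
\<close>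
lemma retention_ge_half:
  assumes st: "state A \<phi> S D" and y: "y \<in> pverts H - A"
  shows "1 / 2 \<le> D y"
proof -
  have D: "0 < D y" using assms by (auto simp: state_def)
  have "(1 / D y) ^ s \<le> potential A D"
    unfolding potential_def
    by (rule member_le_sum[OF y]) (use finite_H st in \<open>auto simp: state_def intro: less_imp_le\<close>)
  also have "\<dots> \<le> real (card (pverts H)) * (1 + 4 * real s * clash_rate) ^ card A"
    using st by (simp add: state_def)
  also have "(1 + 4 * real s * clash_rate) ^ card A \<le> exp (4 * real s * clash_rate) ^ card A"
    using clash_rate_pos by (intro power_mono exp_ge_add_one_self) auto
  also have "\<dots> = exp (real (card A) * (4 * real s * clash_rate))" by (rule exp_of_nat_mult[symmetric])
  also have "real (card A) * (4 * real s * clash_rate) \<le> real (card (pverts H)) * (4 * real s * clash_rate)"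
    using st card_mono[OF finite_H, of A] clash_rate_pos
    by (intro mult_right_mono) (auto simp: state_def)
  also have "\<dots> \<le> 1"
  proof -
    define r where "r = real s * clash_rate * real (card (pverts H))"
    have "8 * r \<le> 1" using few_clashes by (simp only: r_def clash_rate_def mult_ac)
    moreover have "0 \<le> r" using clash_rate_pos by (simp add: r_def)
    moreover have "real (card (pverts H)) * (4 * real s * clash_rate) = 4 * r"
      by (simp only: r_def mult_ac)
    ultimately show ?thesis by linarith
  qed
  also have "exp (1::real) \<le> 3" by (rule exp_le)
  also have "real (card (pverts H)) * 3 \<le> 2 ^ s" using s_large by simp
  finally have "(1 / D y) ^ s \<le> 2 ^ s" by (simp add: mult_left_mono)
  then have "1 / D y \<le> 2" using ranges D by (subst (asm) power_mono_iff) auto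
  then show ?thesis using D by (simp add: field_simps)
qed

text \<open>
  The images of the embedded neighbours of \<open>y\<close> witness that \<open>S y\<close> is candidate-scale, which makes
  both structural hypotheses on \<open>\<Gamma>\<close> and \<open>G\<close> applicable at every step.
\<close>
lemma candidate_set:
  assumes st: "state A \<phi> S D" and y: "y \<in> pverts H - A"
  shows "candidate_scale_with \<Gamma> V p \<Delta> (candidate_ratio d \<Delta>) (\<chi> y) (S y) (\<phi> ` placed_nbrs A y)"
proof -
  let ?P = "placed_nbrs A y"
  have inj: "inj_on \<phi> A"
    using st by (auto simp: state_def fits_def inj_on_def)
  have sub': "?P \<subseteq> A" by (auto simp: placed_nbrs_def)
  have c: "card (\<phi> ` ?P) = card ?P" using inj sub' by (metis card_image inj_on_subset)
  have "?P \<subseteq> {x. (y, x) \<in> parcs H}"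
    using pair_graph_arc_sym[OF H(1)] by (auto simp: placed_nbrs_def)
  then have le: "card ?P \<le> \<Delta>"
    using card_mono[OF finite_nbrs, of ?P y] card_nbrs[of y] y by simp
  have "\<phi> ` ?P \<subseteq> pverts \<Gamma> - V (\<chi> y)"
  proof (rule image_subsetI)
    fix x assume x: "x \<in> ?P"
    then have xA: "x \<in> A" "x \<in> pverts H" and xy: "\<chi> x \<noteq> \<chi> y"
      using st part_neq by (auto simp: placed_nbrs_def state_def)
    have "\<phi> x \<in> V (\<chi> x)" using st xA(1) by (simp add: state_def)
    moreover have "V (\<chi> x) \<subseteq> pverts \<Gamma>" using \<Gamma> part_mem[OF xA(2)] by (auto simp: k_partite_def)
    moreover have "V (\<chi> x) \<inter> V (\<chi> y) = {}" using parts_disjoint part_mem xA y xy by simp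
    ultimately show "\<phi> x \<in> pverts \<Gamma> - V (\<chi> y)" by auto
  qed
  moreover have "S y \<subseteq> common_nbhd_in \<Gamma> (\<phi> ` ?P) (V (\<chi> y))"
  proof -
    have "(\<phi> x, u) \<in> parcs \<Gamma>" if "x \<in> ?P" "u \<in> S y" for x u
      using stateD(2)[OF st y, of x u] that sub by (auto simp: fits_def placed_nbrs_def)
    then show ?thesis using stateD(1)[OF st y] by (auto simp: common_nbhd_in_def nbhd_def)
  qed
  moreover have "candidate_ratio d \<Delta> * p ^ card (\<phi> ` ?P) * real (card (V (\<chi> y))) \<le> real (card (S y))"
  proof -
    have "(d / 2) ^ \<Delta> \<le> (d / 2) ^ card ?P" using le ranges by (intro power_decreasing) auto
    then have "1 / 2 * (d / 2) ^ \<Delta> \<le> D y * (d / 2) ^ card ?P"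
      using retention_ge_half[OF st y] ranges by (intro mult_mono) auto
    then have "candidate_ratio d \<Delta> * (p ^ card ?P * real (card (V (\<chi> y)))) \<le>
       D y * (d / 2) ^ card ?P * (p ^ card ?P * real (card (V (\<chi> y))))"
      using ranges by (intro mult_right_mono) (auto simp: candidate_ratio_def)
    also have "\<dots> = D y * (d / 2 * p) ^ card ?P * real (card (V (\<chi> y)))"
      by (simp only: power_mult_distrib mult_ac)
    also have "\<dots> \<le> real (card (S y))" using stateD(5)[OF st y] .
    finally show ?thesis by (simp only: c mult_ac)
  qed
  ultimately show ?thesis using c le by (simp add: candidate_scale_with_def)
qed

lemma candidate_scale_state:
  assumes "state A \<phi> S D" "y \<in> pverts H - A"
  shows "candidate_scale \<Gamma> V p \<Delta> (candidate_ratio d \<Delta>) (\<chi> y) (S y)"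
  using candidate_set[OF assms] by (auto simp: candidate_scale_def)

lemma candidates_pos:
  assumes st: "state A \<phi> S D" and y: "y \<in> pverts H - A"
  shows "0 < card (S y)" "finite (S y)"
proof -
  have "0 < D y * (d / 2 * p) ^ card (placed_nbrs A y) * real (card (V (\<chi> y)))"
    using stateD(3)[OF st y] ranges V_pos part_mem y by simp
  also have "\<dots> \<le> real (card (S y))" using stateD(5)[OF st y] .
  finally show "0 < card (S y)" by simp
  then show "finite (S y)" by (rule card_ge_0_finite)
qed

text \<open>
  Two sets in different parts are disjoint, so their clashes are edges of \<open>\<Gamma>\<close>. Within a part
  \<open>\<Gamma>\<close> has no edges, so the clashes are the common elements; these are bounded by the second half
  of conflict-goodness for a family consisting of \<open>y\<close> alone with weight one.
\<close>
lemma sum_clash_le: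
  assumes st: "state A \<phi> S D" and x: "x \<in> pverts H - A" and y: "y \<in> pverts H - A"
  shows "(\<Sum>v\<in>S x. real (card (clash \<Gamma> v (S y)))) \<le> clash_rate * real (card (S x)) * real (card (S y))"
proof (cases "\<chi> x = \<chi> y")
  case False
  have "S x \<subseteq> V (\<chi> x)" "S y \<subseteq> V (\<chi> y)" using stateD(1)[OF st] x y by auto
  then have "S x \<inter> S y = {}" using parts_disjoint[OF _ _ False] part_mem x y by blast
  then have "clash \<Gamma> v (S y) = nbhd_in \<Gamma> v (S y)" if "v \<in> S x" for v
    using that by (auto simp: clash_def nbhd_in_def nbhd_def)
  then have "(\<Sum>v\<in>S x. real (card (clash \<Gamma> v (S y)))) = real (edges_between \<Gamma> (S x) (S y))"
    by (simp add: edges_between_eq_sum[OF candidates_pos(2)[OF st x] candidates_pos(2)[OF st y]])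
  also have "\<dots> \<le> C * (p + \<xi>) * real (card (S x)) * real (card (S y))"
    using good candidate_scale_state[OF st] x y False part_mem unfolding conflict_good_def by blast
  finally show ?thesis by (simp add: clash_rate_def)
next
  case True
  have V: "S x \<subseteq> V (\<chi> y)" "S y \<subseteq> V (\<chi> y)" using stateD(1)[OF st] x y True by metis+
  have noarc: "parcs \<Gamma> \<inter> V (\<chi> y) \<times> V (\<chi> y) = {}"
    using \<Gamma> part_mem y by (auto simp: k_partite_def)
  have cl: "real (card (clash \<Gamma> v (S y))) = (if v \<in> S y then 1 else 0)" if "v \<in> S x" for v
  proof -
    have "clash \<Gamma> v (S y) = (if v \<in> S y then {v} else {})"
      using that V noarc by (auto simp: clash_def)
    then show ?thesis by simp
  qed
  have "(\<Sum>v\<in>S x. real (card (clash \<Gamma> v (S y)))) = (\<Sum>v\<in>S x. if v \<in> S y then 1 else 0)"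
    using cl by (intro sum.cong) auto
  also have "\<dots> = real (card (S x \<inter> S y))"
    using candidates_pos(2)[OF st x] by (simp add: sum.If_cases)
  also have "\<dots> \<le> \<xi> * (real (card (S x)) * real (card (S y)))"
  proof -
    let ?W = "\<lambda>z. \<phi> ` placed_nbrs A z"
    have cx: "candidate_scale_with \<Gamma> V p \<Delta> (candidate_ratio d \<Delta>) (\<chi> y) (S x) (?W x)"
      using candidate_set[OF st x] True by simp
    have cy: "candidate_scale_with \<Gamma> V p \<Delta> (candidate_ratio d \<Delta>) (\<chi> y) (S y) (?W y)"
      using candidate_set[OF st y] .
    have one: "card {z \<in> {0::nat}. v \<in> ?W y} \<le> \<Delta>" for v
    proof -
      have "card {z \<in> {0::nat}. v \<in> ?W y} \<le> card {0::nat}" by (intro card_mono) auto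
      then show ?thesis using ranges(1) by simp
    qed
    have "(\<Sum>z\<in>{z \<in> {0::nat}. \<chi> y = \<chi> y}. 1 * (real (card (S x \<inter> S y)) / (real (card (S x)) * real (card (S y)))))
        \<le> \<xi> * (\<Sum>z\<in>{z \<in> {0::nat}. \<chi> y = \<chi> y}. 1)"
      using good[unfolded conflict_good_def, THEN conjunct2, rule_format,
          of "\<chi> y" "{0}" "\<lambda>_. \<chi> y" "\<lambda>_. ?W y" "S x" "?W x" "\<lambda>_. S y" "\<lambda>_. 1"]
        cx cy one part_mem y by simp
    then show ?thesis
      using candidates_pos(1)[OF st x] candidates_pos(1)[OF st y] by (simp add: divide_le_eq)
  qed
  also have "\<dots> \<le> clash_rate * (real (card (S x)) * real (card (S y)))"
  proof -
    have "1 * \<xi> \<le> C * (p + \<xi>)" using ranges by (intro mult_mono) auto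
    then show ?thesis by (intro mult_right_mono) (auto simp: clash_rate_def)
  qed
  finally show ?thesis by (simp add: mult.assoc)
qed

section \<open>Typical images\<close>

lemma pair_regular:
  assumes st: "state A \<phi> S D" and y: "y \<in> pverts H - A" "z \<in> pverts H - A" "(y, z) \<in> parcs H"
  shows "lower_regular G (\<epsilon> 1) d p (S y) (S z)"
proof -
  have "1 / 2 * (1 / 2) \<le> D y * D z"
    using retention_ge_half[OF st] y by (intro mult_mono) (auto intro: order_trans[of _ "1/2"])
  then have "tolerance \<Delta> / 4 / (D y * D z) \<le> tolerance \<Delta> / 4 / (1 / 4)"
    using tolerance_pos by (intro divide_left_mono) auto
  then have le: "tolerance \<Delta> / 4 / (D y * D z) \<le> tolerance \<Delta>" by simp
  show ?thesis unfolding \<epsilon>1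
    by (rule lower_regular_subset[OF stateD(6)[OF st y] subset_refl subset_refl le])
      (use ranges in simp, rule mult_right_mono[OF le], simp, rule mult_right_mono[OF le], simp)
qed

text \<open>
  The set that inheritance speaks about after placing \<open>x\<close> at \<open>v\<close>. It contains the next
  candidate set, which is cut with \<open>G\<close> in place of \<open>\<Gamma>\<close> or reduced by a clash.
\<close>
definition inherited_set :: "'h \<Rightarrow> 'v \<Rightarrow> ('h \<Rightarrow> 'v set) \<Rightarrow> 'h \<Rightarrow> 'v set" where
  "inherited_set x v S z = (if (x, z) \<in> parcs H then nbhd_in \<Gamma> v (S z) else S z)"

lemma few_small_degree:
  assumes st: "state A \<phi> S D" and x: "x \<in> pverts H - A" and y: "y \<in> pverts H - A" "(x, y) \<in> parcs H"
  shows "real (card {v \<in> S x. \<not> d / 2 * p * real (card (S y)) \<le> real (card (nbhd_in G v (S y)))})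
    \<le> tolerance \<Delta> * real (card (S x))"
proof -
  have "1 < 2 * \<Delta>" using ranges by simp
  then show ?thesis
    using inherit[unfolded envelope_positively_inheriting_def, rule_format,
        of 1 "\<chi> x" "\<chi> y" "\<chi> y" "S x" "S y" "S y", THEN conjunct1]
      candidate_scale_state[OF st] x y part_mem part_neq[OF y(2)] pair_regular[OF st x y] \<epsilon>1
    by simp
qed

text \<open>
  Markov's inequality applied to the edge bound of conflict-goodness; \<open>\<xi> \<le> p\<close> turns the density
  \<open>C(p + \<xi>)\<close> into \<open>2Cp\<close>.
\<close>
lemma few_large_degree:
  assumes st: "state A \<phi> S D" and x: "x \<in> pverts H - A" and y: "y \<in> pverts H - A" "(x, y) \<in> parcs H"
  shows "real (card {v \<in> S x. 16 * real \<Delta> * C * p * real (card (S y)) < real (card (nbhd_in \<Gamma> v (S y)))})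
    \<le> real (card (S x)) / (8 * real \<Delta>)"
proof -
  let ?f = "\<lambda>v. real (card (nbhd_in \<Gamma> v (S y)))"
  let ?t = "16 * real \<Delta> * C * p * real (card (S y))"
  have pos: "0 < real (card (S y))" using candidates_pos(1)[OF st y(1)] by simp
  have "sum ?f (S x) = real (edges_between \<Gamma> (S x) (S y))"
    by (simp add: edges_between_eq_sum[OF candidates_pos(2)[OF st x] candidates_pos(2)[OF st y(1)]])
  also have "\<dots> \<le> C * (p + \<xi>) * real (card (S x)) * real (card (S y))"
    using good candidate_scale_state[OF st] x y part_mem part_neq[OF y(2)]
    unfolding conflict_good_def by blast
  also have "\<dots> \<le> C * (2 * p) * real (card (S x)) * real (card (S y))"
    using ranges by (intro mult_right_mono mult_left_mono) auto
  finally have "?t * real (card {v \<in> S x. ?t < ?f v}) \<le> C * (2 * p) * real (card (S x)) * real (card (S y))"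
    by (intro card_above_le candidates_pos(2)[OF st x]) auto
  then have "(2 * C * p * real (card (S y))) * (8 * real \<Delta> * real (card {v \<in> S x. ?t < ?f v}))
      \<le> (2 * C * p * real (card (S y))) * real (card (S x))"
    by (simp only: mult_ac)
  then have "8 * real \<Delta> * real (card {v \<in> S x. ?t < ?f v}) \<le> real (card (S x))"
    using pos ranges by (subst (asm) mult_le_cancel_left_pos) auto
  then show ?thesis using ranges by (simp add: le_divide_eq mult_ac)
qed

text \<open>
  If \<open>z\<close> is a neighbour of \<open>x\<close> as well, then \<open>x\<close>, \<open>y\<close>, \<open>z\<close> form a triangle and lie in three
  different parts, so both sides of the pair may be cut. Otherwise only one side is cut, and \<open>x\<close>
  and \<open>z\<close> may share a part.
\<close>
lemma few_irregular:
  assumes st: "state A \<phi> S D" and x: "x \<in> pverts H - A"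
    and y: "y \<in> pverts H - A" "(x, y) \<in> parcs H" and z: "z \<in> pverts H - A" "(y, z) \<in> parcs H"
  shows "real (card {v \<in> S x. \<not> lower_regular G (\<eta> 1) d p (nbhd_in \<Gamma> v (S y)) (inherited_set x v S z)})
    \<le> tolerance \<Delta> * real (card (S x))"
proof -
  have 1: "1 < 2 * \<Delta>" using ranges by simp
  note use = inherit[unfolded envelope_positively_inheriting_def, rule_format,
      of 1 "\<chi> x" "\<chi> y" "\<chi> z" "S x" "S y" "S z", THEN conjunct2]
  show ?thesis
  proof (cases "(x, z) \<in> parcs H")
    case True
    then show ?thesis
      using use[THEN conjunct2] 1 candidate_scale_state[OF st] x y z part_mem
        part_neq[OF y(2)] part_neq[OF z(2)] part_neq[OF True] pair_regular[OF st y(1) z] \<epsilon>1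
      by (simp add: inherited_set_def)
  next
    case False
    then show ?thesis
      using use[THEN conjunct1] 1 candidate_scale_state[OF st] x y z part_mem
        part_neq[OF y(2)] part_neq[OF z(2)] pair_regular[OF st y(1) z] \<epsilon>1
      by (simp add: inherited_set_def)
  qed
qed

text \<open>
  Markov's inequality at the threshold \<open>1/(2s)\<close>, the largest single loss the potential can absorb.
\<close>
lemma few_large_clash:
  assumes st: "state A \<phi> S D" and x: "x \<in> pverts H - A" and y: "y \<in> pverts H - A"
  shows "real (card {v \<in> S x. real (card (S y)) < 2 * real s * real (card (clash \<Gamma> v (S y)))})
    \<le> 2 * real s * clash_rate * real (card (S x))"
proof -
  let ?f = "\<lambda>v. 2 * real s * real (card (clash \<Gamma> v (S y)))"
  have pos: "0 < real (card (S y))" using candidates_pos(1)[OF st y] by simp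
  have "sum ?f (S x) \<le> 2 * real s * (clash_rate * real (card (S x)) * real (card (S y)))"
    unfolding sum_distrib_left[symmetric] by (intro mult_left_mono sum_clash_le[OF st x y]) auto
  then have "real (card (S y)) * real (card {v \<in> S x. real (card (S y)) < ?f v})
      \<le> 2 * real s * (clash_rate * real (card (S x)) * real (card (S y)))"
    by (intro card_above_le candidates_pos(2)[OF st x]) auto
  then have "real (card (S y)) * real (card {v \<in> S x. real (card (S y)) < ?f v})
      \<le> real (card (S y)) * (2 * real s * clash_rate * real (card (S x)))"
    by (simp only: mult_ac)
  then show ?thesis using pos by (subst (asm) mult_le_cancel_left_pos) auto
qed

definition good_vertex :: "'h set \<Rightarrow> ('h \<Rightarrow> 'v set) \<Rightarrow> 'h \<Rightarrow> 'v \<Rightarrow> bool" where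
  "good_vertex A S x v \<longleftrightarrow>
     (\<forall>y\<in>pverts H - A. (x, y) \<in> parcs H \<longrightarrow>
        d / 2 * p * real (card (S y)) \<le> real (card (nbhd_in G v (S y))) \<and>
        real (card (nbhd_in \<Gamma> v (S y))) \<le> 16 * real \<Delta> * C * p * real (card (S y)) \<and>
        (\<forall>z\<in>pverts H - A. (y, z) \<in> parcs H \<longrightarrow>
           lower_regular G (\<eta> 1) d p (nbhd_in \<Gamma> v (S y)) (inherited_set x v S z))) \<and>
     (\<forall>y\<in>pverts H - A. 2 * real s * real (card (clash \<Gamma> v (S y))) \<le> real (card (S y)))"

text \<open>
  Union bound: exceptional degrees and pairs take at most a share \<open>1/16 + 1/8 + 1/16\<close>, since \<open>x\<close>
  has at most \<open>\<Delta>\<close> neighbours with at most \<open>\<Delta>\<close> neighbours each. Large clashes have to be avoided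
  for all \<open>n\<close> vertices and take at most a share \<open>1/4\<close>.
\<close>
lemma half_good:
  assumes st: "state A \<phi> S D" and x: "x \<in> pverts H - A"
  shows "real (card (S x)) \<le> 2 * real (card {v \<in> S x. good_vertex A S x v})"
proof -
  define c where "c = real (card (S x))"
  define N where "N = {y \<in> pverts H - A. (x, y) \<in> parcs H}"
  define P where "P = (SIGMA y:N. {z \<in> pverts H - A. (y, z) \<in> parcs H})"
  define B1 where "B1 = (\<Union>y\<in>N. {v \<in> S x. \<not> d / 2 * p * real (card (S y)) \<le> real (card (nbhd_in G v (S y)))})"
  define B2 where "B2 = (\<Union>y\<in>N. {v \<in> S x. 16 * real \<Delta> * C * p * real (card (S y)) < real (card (nbhd_in \<Gamma> v (S y)))})"
  define B3 where "B3 = (\<Union>q\<in>P. {v \<in> S x. \<not> lower_regular G (\<eta> 1) d p (nbhd_in \<Gamma> v (S (fst q))) (inherited_set x v S (snd q))})"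
  define B4 where "B4 = (\<Union>y\<in>pverts H - A. {v \<in> S x. real (card (S y)) < 2 * real s * real (card (clash \<Gamma> v (S y)))})"
  define T where "T = {v \<in> S x. good_vertex A S x v}"
  have c0: "0 \<le> c" by (simp add: c_def)
  have D1: "1 \<le> real \<Delta>" using ranges by simp
  have nb: "card {z \<in> pverts H - A. (y, z) \<in> parcs H} \<le> \<Delta>" if "y \<in> pverts H" for y
    by (rule order_trans[OF card_mono[OF finite_nbrs] card_nbrs[OF that]]) auto
  have N: "finite N" "real (card N) \<le> real \<Delta>"
    using nb[of x] x finite_H by (auto simp: N_def)
  have P: "finite P" using N finite_H by (auto simp: P_def)
  have "card P = (\<Sum>y\<in>N. card {z \<in> pverts H - A. (y, z) \<in> parcs H})"
    unfolding P_def using N finite_H by (subst card_SigmaI) auto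
  also have "\<dots> \<le> (\<Sum>y\<in>N. \<Delta>)" by (intro sum_mono nb) (auto simp: N_def)
  finally have "real (card P) \<le> real (card N) * real \<Delta>" by (simp flip: of_nat_mult)
  also have "\<dots> \<le> (real \<Delta>)\<^sup>2" using N by (simp add: power2_eq_square mult_right_mono)
  finally have cP: "real (card P) \<le> (real \<Delta>)\<^sup>2" .
  have "real (card B1) \<le> real \<Delta> * (tolerance \<Delta> * c)"
    unfolding B1_def c_def using N tolerance_pos
    by (intro card_UN_le_mult few_small_degree[OF st x]) (auto simp: N_def)
  also have "\<dots> \<le> c / 16"
    using D1 c0 mult_left_mono[OF D1 c0] by (simp add: tolerance_def power2_eq_square field_simps)
  finally have b1: "real (card B1) \<le> c / 16" .
  have "real (card B2) \<le> real \<Delta> * (c / (8 * real \<Delta>))"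
    unfolding B2_def c_def using N
    by (intro card_UN_le_mult few_large_degree[OF st x]) (auto simp: N_def)
  also have "\<dots> = c / 8" using D1 by simp
  finally have b2: "real (card B2) \<le> c / 8" .
  have "real (card B3) \<le> (real \<Delta>)\<^sup>2 * (tolerance \<Delta> * c)"
    unfolding B3_def c_def using P cP tolerance_pos
    by (intro card_UN_le_mult few_irregular[OF st x]) (auto simp: P_def N_def)
  also have "\<dots> = c / 16" using D1 by (simp add: tolerance_def)
  finally have b3: "real (card B3) \<le> c / 16" .
  have "real (card B4) \<le> real (card (pverts H)) * (2 * real s * clash_rate * c)"
    unfolding B4_def c_def using finite_H clash_rate_pos
    by (intro card_UN_le_mult few_large_clash[OF st x]) (auto intro: card_mono)
  also have "\<dots> \<le> c / 4"
  proof -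
    have "(8 * real s * (C * (p + \<xi>)) * real (card (pverts H))) * c \<le> 1 * c"
      using few_clashes c0 by (rule mult_right_mono)
    then show ?thesis by (simp add: clash_rate_def mult_ac)
  qed
  finally have b4: "real (card B4) \<le> c / 4" .
  have "S x \<subseteq> T \<union> (B1 \<union> B2 \<union> (B3 \<union> B4))"
    unfolding T_def good_vertex_def B1_def B2_def B3_def B4_def P_def N_def
    by (auto simp: not_le not_less)
  moreover have "T \<union> (B1 \<union> B2 \<union> (B3 \<union> B4)) \<subseteq> S x"
    unfolding T_def B1_def B2_def B3_def B4_def by auto
  ultimately have eq: "S x = T \<union> (B1 \<union> B2 \<union> (B3 \<union> B4))" by blast
  have "card (S x) \<le> card T + (card B1 + card B2 + (card B3 + card B4))"
    unfolding eq
    by (intro order_trans[OF card_Un_le] add_mono order_refl)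
  then have "c \<le> real (card T) + (real (card B1) + real (card B2) + (real (card B3) + real (card B4)))"
    unfolding c_def by linarith
  then show ?thesis using b1 b2 b3 b4 unfolding c_def[symmetric] T_def[symmetric] by linarith
qed

text \<open>
  Restricting to the good half of the candidates at most doubles an average, so some good vertex has
  a weighted loss of at most twice the clash rate.
\<close>
lemma exists_good_vertex:
  fixes w :: "'h \<Rightarrow> real"
  assumes st: "state A \<phi> S D" and x: "x \<in> pverts H - A"
    and Q: "Q \<subseteq> pverts H - A" and w: "\<And>y. y \<in> Q \<Longrightarrow> 0 \<le> w y"
  shows "\<exists>v\<in>S x. good_vertex A S x v \<and>
    (\<Sum>y\<in>Q. w y * (real (card (clash \<Gamma> v (S y))) / real (card (S y)))) \<le> 2 * clash_rate * sum w Q"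
proof -
  let ?T = "{v \<in> S x. good_vertex A S x v}"
  let ?l = "\<lambda>v y. real (card (clash \<Gamma> v (S y))) / real (card (S y))"
  have fin: "finite ?T" "finite (S x)" using candidates_pos(2)[OF st x] by auto
  have c: "0 < real (card (S x))" using candidates_pos(1)[OF st x] by simp
  then have ne: "?T \<noteq> {}" using half_good[OF st x] by force
  have W: "0 \<le> sum w Q" using w by (intro sum_nonneg) auto
  have avg: "(\<Sum>v\<in>S x. ?l v y) \<le> clash_rate * real (card (S x))" if "y \<in> Q" for y
  proof -
    have y: "y \<in> pverts H - A" using that Q by auto
    have "(\<Sum>v\<in>S x. ?l v y) = (\<Sum>v\<in>S x. real (card (clash \<Gamma> v (S y)))) / real (card (S y))"
      by (rule sum_divide_distrib[symmetric])
    then show ?thesis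
      using sum_clash_le[OF st x y] candidates_pos(1)[OF st y] by (simp add: divide_le_eq)
  qed
  have "(\<Sum>v\<in>?T. \<Sum>y\<in>Q. w y * ?l v y) \<le> (\<Sum>v\<in>S x. \<Sum>y\<in>Q. w y * ?l v y)"
    using fin w by (intro sum_mono2 sum_nonneg mult_nonneg_nonneg) auto
  also have "\<dots> = (\<Sum>y\<in>Q. w y * (\<Sum>v\<in>S x. ?l v y))"
    by (subst sum.swap) (simp add: sum_distrib_left)
  also have "\<dots> \<le> (\<Sum>y\<in>Q. w y * (clash_rate * real (card (S x))))"
    using w avg by (intro sum_mono mult_left_mono) auto
  also have "\<dots> = sum w Q * clash_rate * real (card (S x))"
    by (simp add: sum_distrib_right mult.assoc)
  also have "\<dots> \<le> sum w Q * clash_rate * (2 * real (card ?T))"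
    using W clash_rate_pos half_good[OF st x] by (intro mult_left_mono) auto
  finally have "(\<Sum>v\<in>?T. \<Sum>y\<in>Q. w y * ?l v y) \<le> (2 * clash_rate * sum w Q) * real (card ?T)"
    by (simp add: mult_ac)
  from exists_le_average[OF fin(1) ne this] show ?thesis by auto
qed

section \<open>Embedding one more vertex\<close>

definition next_set :: "'h \<Rightarrow> 'v \<Rightarrow> ('h \<Rightarrow> 'v set) \<Rightarrow> 'h \<Rightarrow> 'v set" where
  "next_set x v S y = {u \<in> S y. fits H G \<Gamma> x y v u}"

definition next_retention :: "'h \<Rightarrow> 'v \<Rightarrow> ('h \<Rightarrow> 'v set) \<Rightarrow> ('h \<Rightarrow> real) \<Rightarrow> 'h \<Rightarrow> real" where
  "next_retention x v S D y = (if (x, y) \<in> parcs H then D y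
     else D y * (1 - real (card (clash \<Gamma> v (S y))) / real (card (S y))))"

lemma next_set_nbr: "(x, y) \<in> parcs H \<Longrightarrow> next_set x v S y = nbhd_in G v (S y)"
  using pair_graph_no_loop[OF graphs(1)] by (auto simp: next_set_def fits_def nbhd_in_def nbhd_def)

lemma next_set_non_nbr: "(x, y) \<notin> parcs H \<Longrightarrow> next_set x v S y = S y - clash \<Gamma> v (S y)"
  by (auto simp: next_set_def fits_def clash_def)

lemma clash_fraction:
  assumes st: "state A \<phi> S D" and v: "good_vertex A S x v" and y: "y \<in> pverts H - A"
  shows "2 * real s * (real (card (clash \<Gamma> v (S y))) / real (card (S y))) \<le> 1"
    "real (card (clash \<Gamma> v (S y))) / real (card (S y)) \<le> 1 / 2"
proof -
  let ?l = "real (card (clash \<Gamma> v (S y))) / real (card (S y))"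
  have "2 * real s * real (card (clash \<Gamma> v (S y))) \<le> real (card (S y))"
    using v y by (auto simp: good_vertex_def)
  then show *: "2 * real s * ?l \<le> 1"
    using candidates_pos(1)[OF st y] by (simp add: divide_le_eq)
  have "1 * ?l \<le> real s * ?l" using ranges by (intro mult_right_mono) auto
  then show "?l \<le> 1 / 2" using * by linarith
qed

lemma next_retention_bounds:
  assumes st: "state A \<phi> S D" and v: "good_vertex A S x v" and y: "y \<in> pverts H - A"
  shows "0 < next_retention x v S D y" "next_retention x v S D y \<le> D y"
    "next_retention x v S D y \<le> 1"
proof -
  have D: "0 < D y" "D y \<le> 1" using stateD(3,4)[OF st y] .
  let ?l = "real (card (clash \<Gamma> v (S y))) / real (card (S y))"
  have l: "0 \<le> ?l" "?l \<le> 1 / 2" using clash_fraction(2)[OF st v y] by auto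
  then have "D y * (1 - ?l) \<le> D y * 1" using D by (intro mult_left_mono) auto
  then show "next_retention x v S D y \<le> D y" by (simp add: next_retention_def)
  then show "next_retention x v S D y \<le> 1" using D by linarith
  have "0 < D y * (1 - ?l)" using l D by (intro mult_pos_pos) linarith+
  then show "0 < next_retention x v S D y" using D by (simp add: next_retention_def)
qed

lemma card_next_set_non_nbr:
  assumes st: "state A \<phi> S D" and y: "y \<in> pverts H - A" "(x, y) \<notin> parcs H"
  shows "D y * real (card (next_set x v S y)) = next_retention x v S D y * real (card (S y))"
proof -
  have sub: "clash \<Gamma> v (S y) \<subseteq> S y" by (auto simp: clash_def)
  have fin: "finite (S y)" "0 < card (S y)" using candidates_pos[OF st y(1)] by auto
  have "real (card (next_set x v S y)) = real (card (S y)) - real (card (clash \<Gamma> v (S y)))"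
    unfolding next_set_non_nbr[OF y(2)]
    using card_Diff_subset[OF finite_subset[OF sub fin(1)] sub] card_mono[OF fin(1) sub] by simp
  moreover have "(1 - real (card (clash \<Gamma> v (S y))) / real (card (S y))) * real (card (S y))
      = real (card (S y)) - real (card (clash \<Gamma> v (S y)))"
    using fin(2) by (simp add: left_diff_distrib)
  ultimately show ?thesis using y(2) by (simp add: next_retention_def mult.assoc)
qed

text \<open>
  The common estimate for neighbours and non-neighbours of \<open>x\<close>: a constant share of the inherited
  set remains, up to the retention. For neighbours the ratio of the two degree bounds is used.
\<close>
lemma next_set_ge_inherited:
  assumes st: "state A \<phi> S D" and v: "good_vertex A S x v" and y: "y \<in> pverts H - A"
  shows "nbhd_fraction d C \<Delta> * real (card (inherited_set x v S y)) * next_retention x v S D y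
    \<le> real (card (next_set x v S y))"
proof (cases "(x, y) \<in> parcs H")
  case True
  have a: "nbhd_fraction d C \<Delta> * (16 * real \<Delta> * C) = d / 2"
    using ranges by (simp add: nbhd_fraction_def)
  have "nbhd_fraction d C \<Delta> * real (card (nbhd_in \<Gamma> v (S y))) * next_retention x v S D y \<le>
      nbhd_fraction d C \<Delta> * real (card (nbhd_in \<Gamma> v (S y))) * 1"
    using nbhd_fraction_bounds next_retention_bounds(3)[OF st v y] by (intro mult_left_mono) auto
  also have "\<dots> \<le> nbhd_fraction d C \<Delta> * (16 * real \<Delta> * C * p * real (card (S y)))"
    using v y True nbhd_fraction_bounds by (auto simp: good_vertex_def)
  also have "\<dots> = (nbhd_fraction d C \<Delta> * (16 * real \<Delta> * C)) * (p * real (card (S y)))"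
    by (simp only: mult_ac)
  also have "\<dots> = d / 2 * p * real (card (S y))" unfolding a by simp
  also have "\<dots> \<le> real (card (nbhd_in G v (S y)))"
    using v y True by (simp add: good_vertex_def)
  finally show ?thesis using True by (simp add: inherited_set_def next_set_nbr)
next
  case False
  have D: "0 < D y" "D y \<le> 1" using stateD(3,4)[OF st y] .
  have "nbhd_fraction d C \<Delta> * (next_retention x v S D y * real (card (S y)))
      \<le> 1 * (next_retention x v S D y * real (card (S y)))"
    using nbhd_fraction_bounds next_retention_bounds(1)[OF st v y] by (intro mult_right_mono) auto
  also have "\<dots> = D y * real (card (next_set x v S y))"
    using card_next_set_non_nbr[OF st y False] by simp
  also have "\<dots> \<le> 1 * real (card (next_set x v S y))" using D by (intro mult_right_mono) auto
  finally show ?thesis using False by (simp add: inherited_set_def mult_ac)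
qed

text \<open>
  Inheritance starts the pair afresh with parameter \<open>nbhd_fraction * tolerance / 4\<close>, independently of
  the retentions so far. Passing to the next candidate sets costs the factor \<open>nbhd_fraction\<close>.
\<close>
lemma next_set_regular_nbr:
  assumes st: "state A \<phi> S D" and v: "good_vertex A S x v"
    and y: "y \<in> pverts H - A" "(x, y) \<in> parcs H" and z: "z \<in> pverts H - A" "(y, z) \<in> parcs H"
  shows "lower_regular G (tolerance \<Delta> / 4 / (next_retention x v S D y * next_retention x v S D z)) d p
    (next_set x v S y) (next_set x v S z)"
proof -
  define t where "t = tolerance \<Delta> / 4"
  define a where "a = nbhd_fraction d C \<Delta>"
  define r where "r = next_retention x v S D"
  have t: "0 < t" using tolerance_pos by (simp add: t_def)
  have r: "0 < r w" "r w \<le> 1" if "w \<in> pverts H - A" for w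
    using next_retention_bounds[OF st v that] by (auto simp: r_def)
  have a: "0 < a" "a \<le> 1" using nbhd_fraction_bounds by (auto simp: a_def)
  \<comment> \<open>A retention of at most one on the other side only enlarges the new parameter.\<close>
  have ge: "a * t * real (card (inherited_set x v S w)) \<le> t / (r w * r w') * real (card (next_set x v S w))"
    if w: "w \<in> pverts H - A" "w' \<in> pverts H - A" for w w'
  proof -
    have "a * real (card (inherited_set x v S w)) * r w * r w' \<le> real (card (next_set x v S w)) * 1"
      using next_set_ge_inherited[OF st v w(1)] r[OF w(2)]
      by (intro mult_mono) (auto simp: a_def r_def)
    then have "t * (a * real (card (inherited_set x v S w)) * r w * r w') \<le> t * real (card (next_set x v S w))"
      using t by simp
    then show ?thesis using r[OF w(1)] r[OF w(2)] by (simp add: le_divide_eq mult_ac)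
  qed
  have reg: "lower_regular G (a * t) d p (inherited_set x v S y) (inherited_set x v S z)"
  proof -
    have "inherited_set x v S y = nbhd_in \<Gamma> v (S y)" using y(2) by (simp add: inherited_set_def)
    moreover have "lower_regular G (\<eta> 1) d p (nbhd_in \<Gamma> v (S y)) (inherited_set x v S z)"
      using v y z unfolding good_vertex_def by blast
    ultimately show ?thesis by (simp only: \<eta>1 a_def t_def)
  qed
  have sub': "next_set x v S w \<subseteq> inherited_set x v S w" for w
    using sub by (auto simp: next_set_def inherited_set_def fits_def nbhd_in_def nbhd_def)
  have le: "a * t \<le> t / (r y * r z)"
  proof -
    have "a * t \<le> 1 * t" using a t by (intro mult_right_mono) auto
    moreover have "r y * r z \<le> 1 * 1" using r y z by (intro mult_mono) (auto intro: less_imp_le)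
    then have "t * (r y * r z) \<le> t * 1" using t by (intro mult_left_mono) auto
    then have "t \<le> t / (r y * r z)" using r y z by (simp add: le_divide_eq)
    ultimately show ?thesis by simp
  qed
  show ?thesis
    unfolding t_def[symmetric] r_def[symmetric]
    using ge[OF z(1) y(1)] ranges
    by (intro lower_regular_subset[OF reg sub' sub' le _ ge[OF y(1) z(1)]])
      (simp_all add: mult.commute)
qed

text \<open>
  If neither end is a neighbour of \<open>x\<close>, both sets shrink by clashes only, and the parameter grows
  exactly as the retentions fall.
\<close>
lemma next_set_regular:
  assumes st: "state A \<phi> S D" and v: "good_vertex A S x v"
    and y: "y \<in> pverts H - A" and z: "z \<in> pverts H - A" "(y, z) \<in> parcs H"
  shows "lower_regular G (tolerance \<Delta> / 4 / (next_retention x v S D y * next_retention x v S D z)) d p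
    (next_set x v S y) (next_set x v S z)"
proof -
  have zy: "(z, y) \<in> parcs H" using pair_graph_arc_sym[OF H(1) z(2)] .
  consider "(x, y) \<in> parcs H" | "(x, z) \<in> parcs H" | "(x, y) \<notin> parcs H" "(x, z) \<notin> parcs H" by blast
  then show ?thesis
  proof cases
    case 1
    then show ?thesis using next_set_regular_nbr[OF st v y _ z] by blast
  next
    case 2
    then show ?thesis
      using lower_regular_commute[OF graphs(1) next_set_regular_nbr[OF st v z(1) _ y zy]]
      by (simp add: mult.commute)
  next
    case 3
    define t where "t = tolerance \<Delta> / 4"
    define r where "r = next_retention x v S D"
    have t: "0 < t" using tolerance_pos by (simp add: t_def)
    have D: "0 < D w" if "w \<in> pverts H - A" for w using stateD(3)[OF st that] .
    have r: "0 < r w" "r w \<le> D w" if "w \<in> pverts H - A" for w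
      using next_retention_bounds[OF st v that] by (auto simp: r_def)
    have ge: "t / (D w * D w') * real (card (S w)) \<le> t / (r w * r w') * real (card (next_set x v S w))"
      if w: "w \<in> pverts H - A" "w' \<in> pverts H - A" "(x, w) \<notin> parcs H" for w w'
    proof -
      have e: "real (card (next_set x v S w)) = r w * real (card (S w)) / D w"
        using card_next_set_non_nbr[OF st w(1,3), of v] D[OF w(1)] by (simp add: r_def field_simps)
      have "t / (D w * D w') * real (card (S w)) = (t * real (card (S w)) / D w) / D w'" by simp
      also have "\<dots> \<le> (t * real (card (S w)) / D w) / r w'"
        using r[OF w(2)] t D[OF w(1)] D[OF w(2)] by (intro divide_left_mono) auto
      also have "\<dots> = t / (r w * r w') * real (card (next_set x v S w))"
        unfolding e using r[OF w(1)] by simp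
      finally show ?thesis .
    qed
    have le: "t / (D y * D z) \<le> t / (r y * r z)"
    proof (intro divide_left_mono mult_mono mult_pos_pos)
      show "r y \<le> D y" "r z \<le> D z" "0 < r y" "0 < r z" "0 < D y" "0 < D z"
        using r y z(1) D by auto
    qed (use D[OF y] r(1)[OF z(1)] t in simp_all)
    have reg: "lower_regular G (t / (D y * D z)) d p (S y) (S z)"
      using stateD(6)[OF st y z] by (simp only: t_def)
    have sub': "next_set x v S w \<subseteq> S w" for w by (auto simp: next_set_def)
    show ?thesis
      unfolding t_def[symmetric] r_def[symmetric]
      using ge[OF z(1) y 3(2)] ranges
      by (intro lower_regular_subset[OF reg sub' sub' le _ ge[OF y z(1) 3(1)]])
        (simp_all add: mult.commute)
  qed
qed

lemma next_set_size:
  assumes st: "state A \<phi> S D" and v: "good_vertex A S x v" and x: "x \<in> pverts H - A"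
    and y: "y \<in> pverts H - A"
  shows "next_retention x v S D y * (d / 2 * p) ^ card (placed_nbrs (insert x A) y) * real (card (V (\<chi> y)))
    \<le> real (card (next_set x v S y))"
proof (cases "(x, y) \<in> parcs H")
  case True
  have "finite A" using st finite_H finite_subset by (auto simp: state_def)
  then have "finite (placed_nbrs A y)" by (simp add: placed_nbrs_def)
  moreover have "placed_nbrs (insert x A) y = insert x (placed_nbrs A y)" "x \<notin> placed_nbrs A y"
    using True x by (auto simp: placed_nbrs_def)
  ultimately have "card (placed_nbrs (insert x A) y) = Suc (card (placed_nbrs A y))" by simp
  then have "next_retention x v S D y * (d / 2 * p) ^ card (placed_nbrs (insert x A) y) * real (card (V (\<chi> y)))
      = d / 2 * p * (D y * (d / 2 * p) ^ card (placed_nbrs A y) * real (card (V (\<chi> y))))"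
    using True by (simp add: next_retention_def mult_ac)
  also have "\<dots> \<le> d / 2 * p * real (card (S y))"
    using stateD(5)[OF st y] ranges by (intro mult_left_mono) auto
  also have "\<dots> \<le> real (card (nbhd_in G v (S y)))"
    using v y True by (simp add: good_vertex_def)
  finally show ?thesis using True by (simp add: next_set_nbr)
next
  case False
  let ?r = "next_retention x v S D y"
  let ?q = "(d / 2 * p) ^ card (placed_nbrs A y) * real (card (V (\<chi> y)))"
  have D: "0 < D y" using stateD(3)[OF st y] .
  have e: "placed_nbrs (insert x A) y = placed_nbrs A y" using False by (auto simp: placed_nbrs_def)
  have "D y * (?r * ?q) = ?r * (D y * (d / 2 * p) ^ card (placed_nbrs A y) * real (card (V (\<chi> y))))"
    by (simp only: mult_ac)
  also have "\<dots> \<le> ?r * real (card (S y))"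
    using next_retention_bounds(1)[OF st v y] by (intro mult_left_mono stateD(5)[OF st y]) auto
  also have "\<dots> = D y * real (card (next_set x v S y))"
    using card_next_set_non_nbr[OF st y False] by simp
  finally show ?thesis unfolding e using D by (simp only: mult_le_cancel_left_pos mult.assoc)
qed

text \<open>
  Neighbours of \<open>x\<close> keep their retention, so only the clashes of non-neighbours contribute to the
  growth; the averaging hypothesis bounds that contribution by a multiple of the potential.
\<close>
lemma potential_step:
  assumes st: "state A \<phi> S D" and v: "good_vertex A S x v"
    and Q: "Q = {y \<in> pverts H - insert x A. (x, y) \<notin> parcs H}"
    and avg: "(\<Sum>y\<in>Q. (1 / D y) ^ s * (real (card (clash \<Gamma> v (S y))) / real (card (S y))))
      \<le> 2 * clash_rate * (\<Sum>y\<in>Q. (1 / D y) ^ s)"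
  shows "potential (insert x A) (next_retention x v S D) \<le> (1 + 4 * real s * clash_rate) * potential A D"
proof -
  let ?R = "pverts H - insert x A"
  let ?w = "\<lambda>y. (1 / D y) ^ s"
  let ?l = "\<lambda>y. real (card (clash \<Gamma> v (S y))) / real (card (S y))"
  have w: "0 \<le> ?w y" if "y \<in> pverts H - A" for y using stateD(3)[OF st that] by simp
  have fin: "finite ?R" "Q \<subseteq> ?R" using finite_H Q by auto
  have "(1 / next_retention x v S D y) ^ s \<le> ?w y + (if y \<in> Q then 2 * real s * (?w y * ?l y) else 0)"
    if y: "y \<in> ?R" for y
  proof (cases "(x, y) \<in> parcs H")
    case True
    then show ?thesis using Q by (simp add: next_retention_def)
  next
    case False
    have yA: "y \<in> pverts H - A" using y by auto
    have "(1 / next_retention x v S D y) ^ s = ?w y * (1 / (1 - ?l y)) ^ s"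
      using False by (simp add: next_retention_def power_mult_distrib[symmetric])
    also have "\<dots> \<le> ?w y * (1 + 2 * real s * ?l y)"
      using w[OF yA] clash_fraction(1)[OF st v yA] ranges
      by (intro mult_left_mono inverse_power_step) auto
    also have "\<dots> = ?w y + 2 * real s * (?w y * ?l y)" by (simp only: distrib_left mult_1_right mult_ac)
    finally show ?thesis using y False Q by simp
  qed
  then have "potential (insert x A) (next_retention x v S D) \<le>
      (\<Sum>y\<in>?R. ?w y + (if y \<in> Q then 2 * real s * (?w y * ?l y) else 0))"
    unfolding potential_def by (rule sum_mono)
  also have "\<dots> = sum ?w ?R + 2 * real s * (\<Sum>y\<in>Q. ?w y * ?l y)"
    using fin by (simp add: sum.distrib sum.inter_restrict[symmetric] Int_absorb1 sum_distrib_left)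
  also have "\<dots> \<le> sum ?w ?R + 2 * real s * (2 * clash_rate * sum ?w Q)"
    using avg by (intro add_left_mono mult_left_mono) auto
  also have "\<dots> \<le> sum ?w ?R + 2 * real s * (2 * clash_rate * sum ?w ?R)"
    using fin w clash_rate_pos by (intro add_left_mono mult_left_mono sum_mono2) auto
  also have "\<dots> = (1 + 4 * real s * clash_rate) * sum ?w ?R" by (simp add: algebra_simps)
  also have "\<dots> \<le> (1 + 4 * real s * clash_rate) * potential A D"
    unfolding potential_def using finite_H w clash_rate_pos
    by (intro mult_left_mono sum_mono2) auto
  finally show ?thesis .
qed

lemma state_extend:
  assumes st: "state A \<phi> S D" and x: "x \<in> pverts H - A"
  shows "\<exists>\<phi>' S' D'. state (insert x A) \<phi>' S' D'"
proof -
  define Q where "Q = {y \<in> pverts H - insert x A. (x, y) \<notin> parcs H}"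
  have w: "0 \<le> (1 / D y) ^ s" if "y \<in> Q" for y
    using stateD(3)[OF st, of y] that by (auto simp: Q_def)
  have "Q \<subseteq> pverts H - A" by (auto simp: Q_def)
  from exists_good_vertex[OF st x this, of "\<lambda>y. (1 / D y) ^ s", OF w] obtain v where vS: "v \<in> S x" and v: "good_vertex A S x v"
    and avg: "(\<Sum>y\<in>Q. (1 / D y) ^ s * (real (card (clash \<Gamma> v (S y))) / real (card (S y))))
      \<le> 2 * clash_rate * (\<Sum>y\<in>Q. (1 / D y) ^ s)"
    by blast
  let ?f = "\<phi>(x := v)" and ?S = "next_set x v S" and ?D = "next_retention x v S D"
  have A: "A \<subseteq> pverts H" "finite A" using st finite_H finite_subset by (auto simp: state_def)
  have "insert x A \<subseteq> pverts H" using A x by auto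
  moreover have "\<forall>y\<in>insert x A. ?f y \<in> V (\<chi> y)"
    using stateD(1)[OF st x] vS st by (auto simp: state_def)
  moreover have "\<forall>y\<in>insert x A. \<forall>z\<in>insert x A. y \<noteq> z \<longrightarrow> fits H G \<Gamma> y z (?f y) (?f z)"
  proof (intro ballI impI)
    fix y z assume yz: "y \<in> insert x A" "z \<in> insert x A" "y \<noteq> z"
    consider "y \<in> A" "z \<in> A" | "y \<in> A" "z = x" | "y = x" "z \<in> A" using yz by auto
    then show "fits H G \<Gamma> y z (?f y) (?f z)"
    proof cases
      case 1
      then show ?thesis using st x yz by (auto simp: state_def)
    next
      case 2
      then show ?thesis using stateD(2)[OF st x 2(1) vS] yz by auto
    next
      case 3
      then show ?thesis using stateD(2)[OF st x 3(2) vS] fits_commute yz by auto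
    qed
  qed
  moreover have "\<forall>y\<in>pverts H - insert x A. ?S y \<subseteq> V (\<chi> y) \<and> (\<forall>z\<in>insert x A. \<forall>u\<in>?S y. fits H G \<Gamma> z y (?f z) u) \<and>
      0 < ?D y \<and> ?D y \<le> 1 \<and>
      ?D y * (d / 2 * p) ^ card (placed_nbrs (insert x A) y) * real (card (V (\<chi> y))) \<le> real (card (?S y))"
  proof (intro ballI[of "pverts H - insert x A"] conjI)
    fix y assume y: "y \<in> pverts H - insert x A"
    have yA: "y \<in> pverts H - A" using y by auto
    show "?S y \<subseteq> V (\<chi> y)" using stateD(1)[OF st yA] by (auto simp: next_set_def)
    show "\<forall>z\<in>insert x A. \<forall>u\<in>?S y. fits H G \<Gamma> z y (?f z) u"
      using stateD(2)[OF st yA] x by (auto simp: next_set_def)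
    show "0 < ?D y" "?D y \<le> 1" using next_retention_bounds[OF st v yA] by auto
    show "?D y * (d / 2 * p) ^ card (placed_nbrs (insert x A) y) * real (card (V (\<chi> y))) \<le> real (card (?S y))"
      by (rule next_set_size[OF st v x yA])
  qed
  moreover have "\<forall>y\<in>pverts H - insert x A. \<forall>z\<in>pverts H - insert x A. (y, z) \<in> parcs H \<longrightarrow>
      lower_regular G (tolerance \<Delta> / 4 / (?D y * ?D z)) d p (?S y) (?S z)"
    using next_set_regular[OF st v] by simp
  moreover have "potential (insert x A) ?D \<le> real (card (pverts H)) * (1 + 4 * real s * clash_rate) ^ card (insert x A)"
  proof -
    have "potential (insert x A) ?D \<le> (1 + 4 * real s * clash_rate) * potential A D"
      by (rule potential_step[OF st v Q_def avg])
    also have "\<dots> \<le> (1 + 4 * real s * clash_rate) *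
        (real (card (pverts H)) * (1 + 4 * real s * clash_rate) ^ card A)"
      using st clash_rate_pos by (intro mult_left_mono) (auto simp: state_def)
    also have "\<dots> = real (card (pverts H)) * (1 + 4 * real s * clash_rate) ^ card (insert x A)"
      using x A by simp
    finally show ?thesis .
  qed
  ultimately have "state (insert x A) ?f ?S ?D" unfolding state_def by (intro conjI)
  then show ?thesis by blast
qed

section \<open>Embedding the whole graph\<close>

lemma state_empty: "state {} \<phi> (\<lambda>y. V (\<chi> y)) (\<lambda>_. 1)"
  unfolding state_def using regular part_mem part_neq
  by (auto simp: placed_nbrs_def potential_def)

lemma embedding_exists:
  "\<exists>\<phi>. part_respecting H \<chi> V \<phi> \<and> acceptable_embedding H G \<Gamma> \<phi>"
proof -
  have "\<exists>\<phi> S D. state A \<phi> S D" if "finite A" "A \<subseteq> pverts H" for A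
    using that
  proof (induction A rule: finite_induct)
    case empty
    then show ?case using state_empty by blast
  next
    case (insert x A)
    then obtain \<phi> S D where "state A \<phi> S D" by blast
    then show ?case using state_extend[of A \<phi> S D x] insert by blast
  qed
  from this[OF finite_H subset_refl] obtain \<phi> S D where st: "state (pverts H) \<phi> S D" by blast
  have V: "\<phi> x \<in> V (\<chi> x)" if "x \<in> pverts H" for x using st that by (simp add: state_def)
  have fits: "fits H G \<Gamma> x y (\<phi> x) (\<phi> y)" if "x \<in> pverts H" "y \<in> pverts H" "x \<noteq> y" for x y
    using st that by (simp add: state_def)
  have "V i \<subseteq> pverts \<Gamma>" if "i \<in> {1..k}" for i using \<Gamma> that by (auto simp: k_partite_def)
  then have "\<phi> ` pverts H \<subseteq> pverts \<Gamma>" using V part_mem by blast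
  moreover have "inj_on \<phi> (pverts H)" using fits by (auto simp: inj_on_def fits_def)
  ultimately have "part_respecting H \<chi> V \<phi> \<and> acceptable_embedding H G \<Gamma> \<phi>"
    using V fits by (auto simp: part_respecting_def acceptable_embedding_def fits_def)
  then show ?thesis by blast
qed

end

text \<open>
  The choice \<open>s = \<lceil>4 log(2n)\<rceil>\<close> meets both demands on the exponent: \<open>s \<le> 6 log(2n)\<close> keeps
  \<open>8 s C (p + \<xi>) n\<close> below one, and \<open>2 ^ s \<ge> exp (s / 2) \<ge> (2n)\<^sup>2\<close> exceeds \<open>3 n\<close>.
\<close>
lemma embedding_below_clash_threshold:
  fixes \<Delta> k :: nat and d C M p \<xi> :: real and \<epsilon> \<eta> :: "nat \<Rightarrow> real"
    and G \<Gamma> :: "'v pair_pre_digraph" and H :: "'h pair_pre_digraph"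
  assumes ranges: "\<Delta> \<ge> 1" "0 < d" "d \<le> 1" "C \<ge> 1" "0 < p" "0 < \<xi>" "\<xi> \<le> p"
    and G: "k_partite k V G" and \<Gamma>: "k_partite k V \<Gamma>" and sub: "parcs G \<subseteq> parcs \<Gamma>"
    and V_pos: "\<And>i. i \<in> {1..k} \<Longrightarrow> 0 < card (V i)"
    and H: "pair_graph H" "max_degree_le H \<Delta>" "proper_assignment H k \<chi>"
    and n: "card (pverts H) = n" "n \<ge> 1"
    and few_clashes: "(p + \<xi>) * real n * ln (2 * real n) \<le> 1 / (48 * C)"
    and good: "conflict_good \<Gamma> k V p \<Delta> (candidate_ratio d \<Delta>) \<xi> C"
    and regular: "\<And>i j. i \<in> {1..k} \<Longrightarrow> j \<in> {1..k} \<Longrightarrow> i \<noteq> j \<Longrightarrow>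
      lower_regular G (tolerance \<Delta> / 4) d p (V i) (V j)"
    and inherit: "envelope_positively_inheriting G \<Gamma> k V \<Delta> (candidate_ratio d \<Delta>) \<epsilon> \<eta> d p"
    and \<epsilon>1: "\<epsilon> 1 = tolerance \<Delta>" and \<eta>1: "\<eta> 1 = nbhd_fraction d C \<Delta> * (tolerance \<Delta> / 4)"
  shows "\<exists>\<phi>. part_respecting H \<chi> V \<phi> \<and> acceptable_embedding H G \<Gamma> \<phi>"
proof -
  define L where "L = ln (2 * real n)"
  define s where "s = nat \<lceil>4 * L\<rceil>"
  have n1: "1 \<le> real n" using n by simp
  have "1 / 2 \<le> ln (2::real)" using exp_half_le2 by (subst ln_ge_iff) auto
  also have "\<dots> \<le> L" using n1 by (simp add: L_def)
  finally have L: "1 / 2 \<le> L" .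
  have s: "4 * L \<le> real s" "real s \<le> 4 * L + 1"
    using L by (simp_all add: s_def)
  then have s1: "1 \<le> s" using L by (cases s) auto
  have few: "8 * real s * (C * (p + \<xi>)) * real (card (pverts H)) \<le> 1"
  proof -
    have "8 * real s \<le> 48 * L" using s L by linarith
    then have "8 * real s * (C * (p + \<xi>) * real n) \<le> 48 * L * (C * (p + \<xi>) * real n)"
      using ranges by (intro mult_right_mono) auto
    also have "\<dots> = 48 * C * ((p + \<xi>) * real n * L)" by (simp only: mult_ac)
    also have "\<dots> \<le> 48 * C * (1 / (48 * C))"
      using few_clashes ranges by (intro mult_left_mono) (auto simp: L_def)
    finally show ?thesis using ranges by (simp add: n mult.assoc)
  qed
  have large: "3 * real (card (pverts H)) \<le> 2 ^ s"
  proof -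
    have "3 * real n \<le> 4 * (real n * real n)" using mult_right_mono[OF n1, of "real n"] by simp
    also have "\<dots> = (2 * real n) * (2 * real n)" by simp
    also have "\<dots> = exp L * exp L" using n1 by (simp add: L_def)
    also have "\<dots> = exp (2 * L)" by (simp flip: exp_add)
    also have "\<dots> \<le> exp (real s * (1 / 2))" using s by simp
    also have "\<dots> = exp (1 / 2) ^ s" by (rule exp_of_nat_mult)
    also have "\<dots> \<le> 2 ^ s" by (intro power_mono exp_half_le2) auto
    finally show ?thesis by (simp add: n)
  qed
  interpret embedding_setting G \<Gamma> k V H \<chi> \<Delta> d C p \<xi> \<epsilon> \<eta> s
    by (rule embedding_setting.intro) (fact ranges G \<Gamma> sub V_pos H good regular inherit \<epsilon>1 \<eta>1 few large s1)+
  show ?thesis by (rule embedding_exists)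
qed

theorem theorem3p1:
  fixes \<Delta> k :: nat and d \<kappa> C :: real
  assumes "\<Delta> \<ge> 1" and "k \<ge> 1" and "0 < d" and "d \<le> 1" and "\<kappa> \<ge> 1" and "C \<ge> 1"
  shows "\<exists>(\<theta>::real) (\<xi>\<^sub>0::real) (lam\<^sub>0::real) (K\<^sub>0::real) (n\<^sub>0::nat) (\<epsilon>::nat \<Rightarrow> real) (\<eta>::nat \<Rightarrow> real).
    0 < \<theta> \<and> \<theta> \<le> 1 \<and> 0 < \<xi>\<^sub>0 \<and> 0 < lam\<^sub>0 \<and> 0 < K\<^sub>0 \<and>
    (\<forall>h\<le>2 * \<Delta>. 0 < \<epsilon> h) \<and> (\<forall>h<2 * \<Delta>. 0 < \<eta> h) \<and>
    (\<forall>(G :: 'v pair_pre_digraph) (\<Gamma> :: 'v pair_pre_digraph) (V :: nat \<Rightarrow> 'v set)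
       (M :: real) (p :: real) (\<xi> :: real)
       (H :: 'h pair_pre_digraph) (n :: nat) (\<chi> :: 'h \<Rightarrow> nat) (B :: 'h set).
       k_partite k V G \<longrightarrow> k_partite k V \<Gamma> \<longrightarrow> spanning (with_proj G) (with_proj \<Gamma>) \<longrightarrow>
       (\<forall>i\<in>{1..k}. M \<le> real (card (V i)) \<and> real (card (V i)) \<le> \<kappa> * M) \<longrightarrow>
       0 < p \<longrightarrow> p \<le> 1 \<longrightarrow>
       pair_graph H \<longrightarrow> card (pverts H) = n \<longrightarrow> n \<ge> n\<^sub>0 \<longrightarrow>
       max_degree_le H \<Delta> \<longrightarrow> proper_assignment H k \<chi> \<longrightarrow>
       (\<forall>i\<in>{1..k}. card {x \<in> pverts H. \<chi> x = i} \<le> card (V i)) \<longrightarrow>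
       separated_buffer H B \<longrightarrow>
       p ^ \<Delta> * M \<ge> K\<^sub>0 * ln (2 * real n) \<longrightarrow>
       (p + \<xi>) * real n * ln (2 * real n) \<le> lam\<^sub>0 \<longrightarrow>
       0 < \<xi> \<longrightarrow> \<xi> \<le> min \<xi>\<^sub>0 p \<longrightarrow>
       conflict_good \<Gamma> k V p \<Delta> \<theta> \<xi> C \<longrightarrow>
       (\<forall>i\<in>{1..k}. \<forall>j\<in>{1..k}. i \<noteq> j \<longrightarrow> lower_regular G (\<epsilon> 0) d p (V i) (V j)) \<longrightarrow>
       envelope_positively_inheriting G \<Gamma> k V \<Delta> \<theta> \<epsilon> \<eta> d p \<longrightarrow>
       (\<exists>\<phi> :: 'h \<Rightarrow> 'v. part_respecting H \<chi> V \<phi> \<and> acceptable_embedding H G \<Gamma> \<phi>))"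
proof -
  \<comment> \<open>Index \<open>0\<close> governs the initial pairs. Its quarter leaves room for the fourfold growth of the
    regularity parameter caused by clashes, after which inheritance is invoked at index \<open>1\<close>.\<close>
  define \<epsilon> where "\<epsilon> = (\<lambda>h::nat. if h = 0 then tolerance \<Delta> / 4 else tolerance \<Delta>)"
  define \<eta> where "\<eta> = (\<lambda>h::nat. nbhd_fraction d C \<Delta> * (tolerance \<Delta> / 4))"
  have pos: "tolerance \<Delta> > 0" "nbhd_fraction d C \<Delta> > 0" "candidate_ratio d \<Delta> > 0"
    using assms by (simp_all add: tolerance_def nbhd_fraction_def candidate_ratio_def)
  have "(d / 2) ^ \<Delta> \<le> 1" using assms by (intro power_le_one) auto
  then have "candidate_ratio d \<Delta> \<le> 1" by (simp add: candidate_ratio_def)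
  with pos have ranges: "0 < candidate_ratio d \<Delta>" "candidate_ratio d \<Delta> \<le> 1" "0 < (1::real)"
    "0 < 1 / (48 * C)" "\<And>h. 0 < \<epsilon> h" "\<And>h. 0 < \<eta> h"
    using assms by (simp_all add: \<epsilon>_def \<eta>_def)
  have main: "\<exists>\<phi> :: 'h \<Rightarrow> 'v. part_respecting H \<chi> V \<phi> \<and> acceptable_embedding H G \<Gamma> \<phi>"
    if G: "k_partite k V G" and \<Gamma>: "k_partite k V \<Gamma>"
      and sp: "spanning (with_proj G) (with_proj \<Gamma>)"
      and M: "\<forall>i\<in>{1..k}. M \<le> real (card (V i)) \<and> real (card (V i)) \<le> \<kappa> * M"
      and p: "0 < p" and H: "pair_graph H" "max_degree_le H \<Delta>" "proper_assignment H k \<chi>"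
      and n: "card (pverts H) = n" "n \<ge> 1"
      and K: "p ^ \<Delta> * M \<ge> 1 * ln (2 * real n)"
      and lam: "(p + \<xi>) * real n * ln (2 * real n) \<le> 1 / (48 * C)"
      and \<xi>: "0 < \<xi>" "\<xi> \<le> min 1 p"
      and good: "conflict_good \<Gamma> k V p \<Delta> (candidate_ratio d \<Delta>) \<xi> C"
      and reg: "\<forall>i\<in>{1..k}. \<forall>j\<in>{1..k}. i \<noteq> j \<longrightarrow> lower_regular G (\<epsilon> 0) d p (V i) (V j)"
      and inherit: "envelope_positively_inheriting G \<Gamma> k V \<Delta> (candidate_ratio d \<Delta>) \<epsilon> \<eta> d p"
    for G \<Gamma> :: "'v pair_pre_digraph" and V M p \<xi> and H :: "'h pair_pre_digraph" and n \<chi>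
  proof (rule embedding_below_clash_threshold)
    \<comment> \<open>The lower bound on \<open>p ^ \<Delta> * M\<close> makes the parts nonempty.\<close>
    have "0 < ln (2 * real n)" using n by simp
    then have "0 < p ^ \<Delta> * M" using K by linarith
    then have "0 < M" using p by (simp add: zero_less_mult_iff)
    then show "0 < card (V i)" if "i \<in> {1..k}" for i
      using M that by (metis not_gr_zero of_nat_0 not_less)
    show "parcs G \<subseteq> parcs \<Gamma>" using sp by (simp add: spanning_def subgraph_def)
    show "lower_regular G (tolerance \<Delta> / 4) d p (V i) (V j)"
      if "i \<in> {1..k}" "j \<in> {1..k}" "i \<noteq> j" for i j
      using reg that by (simp add: \<epsilon>_def)
    show "\<xi> \<le> p" using \<xi> by simp
    show "\<epsilon> 1 = tolerance \<Delta>" "\<eta> 1 = nbhd_fraction d C \<Delta> * (tolerance \<Delta> / 4)"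
      by (simp_all add: \<epsilon>_def \<eta>_def)
  qed (fact assms p \<xi> G \<Gamma> H n lam good inherit)+
  show ?thesis
    by (rule exI[of _ "candidate_ratio d \<Delta>"], rule exI[of _ 1], rule exI[of _ "1 / (48 * C)"],
        rule exI[of _ 1], rule exI[of _ 1], rule exI[of _ \<epsilon>], rule exI[of _ \<eta>])
      (intro conjI allI impI ranges, rule main)
qed

end
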